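(* Let $\beta_1,\beta_2,\dots>0$ be the weights of the subnormal unilateral weighted shift $shift(\beta_1,\beta_2,\dots)$ whose Berger measure is Lebesgue measure $d\eta(t)=dt$ on $[\frac12,\frac32]$. Let $0<a<x<1$ and put $$s:=\sqrt{\frac{1}{\ln 3}\cdot\frac{1-x^2}{1-a^2}},\qquad M:=\min\left\{\frac{x\sqrt{1-x^2}}{\sqrt{x^2+a^4-2a^2x^2}},\ \sqrt{\frac{1}{\ln 3}}\right\}.$$ Then $s<M$. Moreover, for every $y$ with $s<y\le M$, the $2$-variable weighted shift $\mathbf T\equiv(T_1,T_2)$ on $\ell^2(\mathbb Z_+^2)$ with weights $$\alpha_{(0,0)}=x,\quad \alpha_{(0,k_2)}=a\ (k_2\ge1),\quad \alpha_{(k_1,k_2)}=1\ (k_1\ge 1,\ k_2\ge 0),$$ $$\beta_{(0,0)}=y,\quad \beta_{(k_1,0)}=\frac{ay}{x}\ (k_1\ge1),\quad \beta_{(k_1,k_2)}=\beta_{k_2}\ (k_1\ge0,\ k_2\ge1)$$ satisfies: (i) $\mathbf T\in\mathfrak H_1$; (ii) $\mathbf T\notin\mathfrak H_\infty$; (iii) $T_1^mT_2^n$ is subnormal for all $m\ge1$, $n\ge1$.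
   Context: $shift(\omega_0,\omega_1,\dots)$ denotes the unilateral weighted shift $e_n\mapsto\omega_ne_{n+1}$ on $\ell^2(\mathbb Z_+)$. It is subnormal if and only if there is a probability measure $\xi$ on $[0,\|W\|^2]$ (its Berger measure), $W$ being the shift, with $\omega_0^2\cdots\omega_{k-1}^2=\int s^k\,d\xi(s)$ for all $k\ge0$. For bounded families of positive numbers $\alpha_{\mathbf k},\beta_{\mathbf k}$ ($\mathbf k\in\mathbb{Z}_+^2$), the $2$-variable weighted shift $\mathbf T\equiv(T_1,T_2)$ on $\ell^2(\mathbb{Z}_+^2)$ is defined by $T_1e_{\mathbf k}=\alpha_{\mathbf k}e_{\mathbf k+(1,0)}$, $T_2e_{\mathbf k}=\beta_{\mathbf k}e_{\mathbf k+(0,1)}$. A pair $(T_1,T_2)$ on $\mathcal H$ is (jointly) hyponormal if the operator matrix $\begin{pmatrix}[T_1^*,T_1]&[T_2^*,T_1]\\ [T_1^*,T_2]&[T_2^*,T_2]\end{pmatrix}$ is positive on $\mathcal H\oplus\mathcal H$, where $[S,T]=ST-TS$. $\mathfrak H_0$ is the class of commuting pairs of subnormal operators; $\mathfrak H_1$ is the class of (jointly) hyponormal pairs in $\mathfrak H_0$; $\mathfrak H_\infty$ is the class of subnormal pairs, i.e. restrictions of commuting pairs of normal operators to a common invariant subspace. *)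

theory Defs
  imports "HOL-Probability.Probability"
begin

section \<open>Complex Hilbert spaces\<close>

text \<open>A complex inner product space is presented over its underlying real inner product space: the
  real inner product is the real part of the complex one, so norm and topology are those of
  \<open>real_inner\<close>. The complex inner product is linear in its first argument.\<close>

class complex_inner = real_inner +
  fixes scaleC :: "complex \<Rightarrow> 'a \<Rightarrow> 'a" (infixr "*\<^sub>C" 75)
    and cinner :: "'a \<Rightarrow> 'a \<Rightarrow> complex"
  assumes scaleC_add_right: "c *\<^sub>C (x + y) = c *\<^sub>C x + c *\<^sub>C y"
    and scaleC_add_left: "(c + d) *\<^sub>C x = c *\<^sub>C x + d *\<^sub>C x"
    and scaleC_scaleC: "c *\<^sub>C (d *\<^sub>C x) = (c * d) *\<^sub>C x"
    and scaleC_of_real: "complex_of_real r *\<^sub>C x = r *\<^sub>R x"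
    and cinner_commute: "cinner x y = cnj (cinner y x)"
    and cinner_add_left: "cinner (x + y) z = cinner x z + cinner y z"
    and cinner_scaleC_left: "cinner (c *\<^sub>C x) y = c * cinner x y"
    and inner_eq_Re_cinner: "inner x y = Re (cinner x y)"

class chilbert_space = complex_inner + complete_space

definition bounded_clinear :: "('a::complex_inner \<Rightarrow> 'b::complex_inner) \<Rightarrow> bool" where
  "bounded_clinear T \<longleftrightarrow> bounded_linear T \<and> (\<forall>c x. T (c *\<^sub>C x) = c *\<^sub>C T x)"

definition is_adjoint :: "('a::complex_inner \<Rightarrow> 'a) \<Rightarrow> ('a \<Rightarrow> 'a) \<Rightarrow> bool" where
  "is_adjoint T S \<longleftrightarrow> (\<forall>x y. cinner (T x) y = cinner x (S y))"

definition adj :: "('a::complex_inner \<Rightarrow> 'a) \<Rightarrow> 'a \<Rightarrow> 'a" where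
  "adj T = (THE S. is_adjoint T S)"

lemma cinner_complex_parts:
  fixes x y :: "'a::complex_inner"
  shows "cinner x y = Complex (inner x y) (- inner (\<i> *\<^sub>C x) y)"
  by (simp add: complex_eq_iff inner_eq_Re_cinner cinner_scaleC_left)

lemma riesz_representation:
  fixes f :: "'a::{real_inner, complete_space} \<Rightarrow> real"
  assumes f: "bounded_linear f"
  shows "\<exists>w. \<forall>x. f x = inner x w"
proof -
  interpret f: bounded_linear f by (rule f)
  define J where "J x = (norm x)\<^sup>2 - 2 * f x" for x
  obtain c where c: "\<And>x. norm (f x) \<le> norm x * c"
    using f.bounded by blast
  have lower: "- c\<^sup>2 \<le> J x" for x
  proof -
    have "f x \<le> norm x * c" using c[of x] by simp
    moreover have "0 \<le> (norm x - c)\<^sup>2" by simp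
    ultimately show ?thesis by (simp add: J_def power2_diff)
  qed
  define m where "m = (INF x. J x)"
  have bdd: "bdd_below (range J)" using lower by (rule bdd_belowI2)
  have mle: "m \<le> J x" for x unfolding m_def by (rule cINF_lower[OF bdd]) simp
  have ex: "\<exists>x. J x < m + 1 / Suc n" for n
    using cINF_less_iff[of UNIV J "m + 1 / Suc n"] bdd by (auto simp: m_def)
  then obtain X where X: "\<And>n. J (X n) < m + 1 / Suc n" by metis
  have par: "(norm (u - v))\<^sup>2 = 2 * J u + 2 * J v - 4 * J ((1/2) *\<^sub>R (u + v))" for u v
    unfolding J_def power2_norm_eq_inner
    by (simp add: f.add f.scaleR inner_add_left inner_add_right inner_diff_left inner_diff_right
        inner_commute algebra_simps)
  have close: "(norm (X i - X j))\<^sup>2 < 2 / Suc i + 2 / Suc j" for i j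
    using par[of "X i" "X j"] X[of i] X[of j] mle[of "(1/2) *\<^sub>R (X i + X j)"] by simp
  have "Cauchy X"
  proof (rule CauchyI)
    fix e :: real assume e: "0 < e"
    obtain N where N: "4 / e\<^sup>2 < real N" using reals_Archimedean2 by blast
    have "norm (X i - X j) < e" if "i \<ge> N" "j \<ge> N" for i j
    proof -
      have Np: "0 < real N" using N e by (smt (verit) zero_less_divide_iff zero_less_power)
      have "2 / Suc i \<le> 2 / N" "2 / Suc j \<le> 2 / N"
        using that Np by (auto intro!: divide_left_mono)
      then have "(norm (X i - X j))\<^sup>2 < 4 / N" using close[of i j] by simp
      also have "\<dots> < e\<^sup>2" using N e Np by (simp add: field_simps)
      finally show ?thesis using e by (simp add: power_less_imp_less_base)
    qed
    then show "\<exists>M. \<forall>m\<ge>M. \<forall>n\<ge>M. norm (X m - X n) < e" by blast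
  qed
  then obtain w where w: "X \<longlonglongrightarrow> w" using Cauchy_convergent convergent_def by blast
  have "(\<lambda>n. J (X n)) \<longlonglongrightarrow> J w"
    unfolding J_def by (intro tendsto_intros f.tendsto w)
  moreover have "(\<lambda>n. m + 1 / Suc n) \<longlonglongrightarrow> m + 0"
    by (intro tendsto_intros LIMSEQ_Suc[OF lim_1_over_n])
  ultimately have "J w \<le> m + 0"
    by (rule LIMSEQ_le) (use X less_imp_le in blast)
  then have Jw: "J w \<le> J x" for x using mle[of x] by simp
  have "f h = inner h w" for h
  proof -
    define d where "d = inner h w - f h"
    have "0 \<le> 2 * t * d + t\<^sup>2 * inner h h" for t
      using Jw[of "w + t *\<^sub>R h"] unfolding J_def power2_norm_eq_inner d_def
      by (simp add: f.add f.scaleR inner_add_left inner_add_right inner_commute algebra_simps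
          power2_eq_square)
    from this[of "- d / (1 + inner h h)"]
    have "0 \<le> - 2 * d\<^sup>2 / (1 + inner h h) + d\<^sup>2 * inner h h / (1 + inner h h)\<^sup>2"
      by (simp add: power2_eq_square field_simps)
    moreover have p: "0 < 1 + inner h h" by (simp add: add_pos_nonneg)
    moreover have "d\<^sup>2 * inner h h / (1 + inner h h)\<^sup>2 \<le> d\<^sup>2 / (1 + inner h h)"
    proof -
      have "d\<^sup>2 * inner h h / (1 + inner h h)\<^sup>2 \<le> d\<^sup>2 * (1 + inner h h) / (1 + inner h h)\<^sup>2"
        by (intro divide_right_mono mult_left_mono) auto
      also have "\<dots> = d\<^sup>2 / (1 + inner h h)" using p by (simp add: power2_eq_square)
      finally show ?thesis .
    qed
    ultimately have "0 \<le> - (d\<^sup>2 / (1 + inner h h))" by simp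
    then have "d\<^sup>2 \<le> 0" using p by (simp add: divide_le_0_iff zero_le_divide_iff)
    then show ?thesis by (simp add: d_def)
  qed
  then show ?thesis by blast
qed

lemma is_adjoint_unique:
  assumes "is_adjoint T S" "is_adjoint T S'"
  shows "S = S'"
proof
  fix y
  have "cinner x (S y) = cinner x (S' y)" for x
    using assms unfolding is_adjoint_def by metis
  then have "inner x (S y) = inner x (S' y)" for x by (simp add: inner_eq_Re_cinner)
  then have "inner (S y - S' y) (S y - S' y) = 0" by (simp add: inner_diff_right)
  then show "S y = S' y" by simp
qed

lemma adj_eqI: "is_adjoint T S \<Longrightarrow> adj T = S"
  unfolding adj_def by (rule the_equality) (auto intro: is_adjoint_unique)

lemma is_adjoint_adj:
  fixes T :: "'a::chilbert_space \<Rightarrow> 'a"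
  assumes T: "bounded_clinear T"
  shows "is_adjoint T (adj T)"
proof -
  have "\<exists>w. \<forall>x. cinner (T x) y = cinner x w" for y
  proof -
    have "bounded_linear (\<lambda>x. inner (T x) y)"
      using T by (auto simp: bounded_clinear_def
          intro: bounded_linear_compose[OF bounded_linear_inner_left])
    then obtain w where w: "\<And>x. inner (T x) y = inner x w"
      using riesz_representation by blast
    have "cinner (T x) y = cinner x w" for x
      using w T by (simp add: cinner_complex_parts bounded_clinear_def flip: w)
    then show ?thesis by blast
  qed
  then obtain S where "is_adjoint T S" unfolding is_adjoint_def by metis
  then show ?thesis using adj_eqI by metis
qed

section \<open>The spaces \<open>\<ell>\<^sup>2(I)\<close>\<close>

typedef 'i ell2 = "{f :: 'i \<Rightarrow> complex. (\<lambda>i. (cmod (f i))\<^sup>2) summable_on UNIV}"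
  morphisms ell2_nth Abs_ell2
  by (rule exI[of _ "\<lambda>_. 0"]) simp

setup_lifting type_definition_ell2

lemma ell2_nth_summable: "(\<lambda>i. (cmod (ell2_nth x i))\<^sup>2) summable_on UNIV"
  using ell2_nth by auto

lemma ell2_summable_add:
  assumes "(\<lambda>i. (cmod (f i))\<^sup>2) summable_on UNIV" "(\<lambda>i. (cmod (g i))\<^sup>2) summable_on UNIV"
  shows "(\<lambda>i. (cmod (f i + g i))\<^sup>2) summable_on UNIV"
proof (rule summable_on_comparison_test)
  show "(\<lambda>i. 2 * (cmod (f i))\<^sup>2 + 2 * (cmod (g i))\<^sup>2) summable_on UNIV"
    by (intro summable_on_add summable_on_cmult_right assms)
  fix i
  have "(cmod (f i + g i))\<^sup>2 \<le> (cmod (f i) + cmod (g i))\<^sup>2"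
    by (simp add: norm_triangle_ineq power_mono)
  also have "\<dots> \<le> 2 * (cmod (f i))\<^sup>2 + 2 * (cmod (g i))\<^sup>2"
    using sum_squares_bound[of "cmod (f i)" "cmod (g i)"] by (simp add: power2_sum)
  finally show "(cmod (f i + g i))\<^sup>2 \<le> 2 * (cmod (f i))\<^sup>2 + 2 * (cmod (g i))\<^sup>2" .
qed simp

lemma ell2_summable_scale:
  assumes "(\<lambda>i. (cmod (f i))\<^sup>2) summable_on UNIV"
  shows "(\<lambda>i. (cmod (c * f i))\<^sup>2) summable_on UNIV"
  using assms by (simp add: norm_mult power_mult_distrib summable_on_cmult_right)

lemma ell2_summable_cinner:
  assumes "(\<lambda>i. (cmod (f i))\<^sup>2) summable_on UNIV" "(\<lambda>i. (cmod (g i))\<^sup>2) summable_on UNIV"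
  shows "(\<lambda>i. f i * cnj (g i)) summable_on UNIV"
proof (rule Infinite_Sum.abs_summable_summable, rule Infinite_Sum.abs_summable_on_comparison_test')
  show "(\<lambda>i. (cmod (f i))\<^sup>2 + (cmod (g i))\<^sup>2) summable_on UNIV"
    by (intro summable_on_add assms)
  fix i
  show "cmod (f i * cnj (g i)) \<le> (cmod (f i))\<^sup>2 + (cmod (g i))\<^sup>2"
    using sum_squares_bound[of "cmod (f i)" "cmod (g i)"]
      zero_le_mult_iff[of "cmod (f i)" "cmod (g i)"]
    by (simp add: norm_mult del: mult_nonneg_nonneg)
qed

instantiation ell2 :: (type) complex_inner
begin

lift_definition zero_ell2 :: "'a ell2" is "\<lambda>_. 0" by simp
lift_definition plus_ell2 :: "'a ell2 \<Rightarrow> 'a ell2 \<Rightarrow> 'a ell2" is "\<lambda>f g i. f i + g i"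
  by (rule ell2_summable_add)
lift_definition uminus_ell2 :: "'a ell2 \<Rightarrow> 'a ell2" is "\<lambda>f i. - f i" by simp
lift_definition minus_ell2 :: "'a ell2 \<Rightarrow> 'a ell2 \<Rightarrow> 'a ell2" is "\<lambda>f g i. f i - g i"
  subgoal for f g using ell2_summable_add[of f "\<lambda>i. - g i"] by simp
  done
lift_definition scaleC_ell2 :: "complex \<Rightarrow> 'a ell2 \<Rightarrow> 'a ell2" is "\<lambda>c f i. c * f i"
  by (rule ell2_summable_scale)
lift_definition scaleR_ell2 :: "real \<Rightarrow> 'a ell2 \<Rightarrow> 'a ell2" is "\<lambda>r f i. complex_of_real r * f i"
  by (rule ell2_summable_scale)
lift_definition cinner_ell2 :: "'a ell2 \<Rightarrow> 'a ell2 \<Rightarrow> complex"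
  is "\<lambda>f g. \<Sum>\<^sub>\<infinity>i. f i * cnj (g i)" .
lift_definition norm_ell2 :: "'a ell2 \<Rightarrow> real" is "\<lambda>f. sqrt (\<Sum>\<^sub>\<infinity>i. (cmod (f i))\<^sup>2)" .

definition inner_ell2 :: "'a ell2 \<Rightarrow> 'a ell2 \<Rightarrow> real" where
  "inner_ell2 x y = Re (cinner x y)"
definition dist_ell2 :: "'a ell2 \<Rightarrow> 'a ell2 \<Rightarrow> real" where
  "dist_ell2 x y = norm (x - y)"
definition sgn_ell2 :: "'a ell2 \<Rightarrow> 'a ell2" where
  "sgn_ell2 x = scaleR (inverse (norm x)) x"
definition uniformity_ell2 :: "('a ell2 \<times> 'a ell2) filter" where
  "uniformity_ell2 = (INF e\<in>{0 <..}. principal {(x, y). dist x y < e})"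
definition open_ell2 :: "'a ell2 set \<Rightarrow> bool" where
  "open_ell2 U = (\<forall>x\<in>U. eventually (\<lambda>(x', y). x' = x \<longrightarrow> y \<in> U) uniformity)"

instance
proof
  fix x y z :: "'a ell2" and c d :: complex and r q :: real
  have self: "cinner u u = complex_of_real (\<Sum>\<^sub>\<infinity>i. (cmod (ell2_nth u i))\<^sup>2)" for u :: "'a ell2"
    using infsumI[OF has_sum_of_real[OF has_sum_infsum[OF ell2_nth_summable[of u]],
        where 'a = complex]]
    by (simp add: cinner_ell2.rep_eq flip: complex_norm_square)
  show "x + y + z = x + (y + z)" by transfer (simp add: add.assoc)
  show "x + y = y + x" by transfer (simp add: add.commute)
  show "0 + x = x" by transfer simp
  show "- x + x = 0" by transfer simp
  show "x - y = x + - y" by transfer simp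
  show "r *\<^sub>R (x + y) = r *\<^sub>R x + r *\<^sub>R y" by transfer (simp add: algebra_simps)
  show "(r + q) *\<^sub>R x = r *\<^sub>R x + q *\<^sub>R x" by transfer (simp add: algebra_simps)
  show "r *\<^sub>R q *\<^sub>R x = (r * q) *\<^sub>R x" by transfer (simp add: algebra_simps)
  show "1 *\<^sub>R x = x" by transfer simp
  show "c *\<^sub>C (x + y) = c *\<^sub>C x + c *\<^sub>C y" by transfer (simp add: algebra_simps)
  show "(c + d) *\<^sub>C x = c *\<^sub>C x + d *\<^sub>C x" by transfer (simp add: algebra_simps)
  show "c *\<^sub>C (d *\<^sub>C x) = (c * d) *\<^sub>C x" by transfer (simp add: algebra_simps)
  show "complex_of_real r *\<^sub>C x = r *\<^sub>R x" by transfer simp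
  show comm: "cinner x y = cnj (cinner y x)" for x y :: "'a ell2"
    by transfer (simp add: mult.commute flip: infsum_cnj)
  show add: "cinner (x + y) z = cinner x z + cinner y z"
    by transfer (simp add: distrib_right infsum_add ell2_summable_cinner)
  show scale: "cinner (c *\<^sub>C x) y = c * cinner x y" for c
    by transfer (simp add: mult.assoc infsum_cmult_right')
  show "inner x y = Re (cinner x y)" by (fact inner_ell2_def)
  show "inner x y = inner y x" using comm[of x y] by (simp add: inner_ell2_def)
  show "inner (x + y) z = inner x z + inner y z" using add by (simp add: inner_ell2_def)
  have "r *\<^sub>R x = complex_of_real r *\<^sub>C x" by transfer simp
  then show "inner (r *\<^sub>R x) y = r * inner x y" by (simp add: inner_ell2_def scale)
  show "0 \<le> inner x x" by (simp add: inner_ell2_def self infsum_nonneg)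
  show "inner x x = 0 \<longleftrightarrow> x = 0"
  proof
    assume "inner x x = 0"
    then have "(\<Sum>\<^sub>\<infinity>i. (cmod (ell2_nth x i))\<^sup>2) \<le> 0" by (simp add: inner_ell2_def self)
    from nonneg_infsum_le_0D[OF this ell2_nth_summable]
    have "ell2_nth x i = 0" for i by simp
    then show "x = 0" by (metis ell2_nth_inject ext zero_ell2.rep_eq)
  next
    assume "x = 0"
    then show "inner x x = 0" by (simp add: inner_ell2_def self zero_ell2.rep_eq)
  qed
  show "norm x = sqrt (inner x x)" by (simp add: inner_ell2_def self norm_ell2.rep_eq)
  show "dist x y = norm (x - y)" by (fact dist_ell2_def)
  show "sgn x = scaleR (inverse (norm x)) x" by (fact sgn_ell2_def)
  show "(uniformity :: ('a ell2 \<times> 'a ell2) filter) =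
      (INF e\<in>{0 <..}. principal {(x, y). dist x y < e})" by (fact uniformity_ell2_def)
  show "open U = (\<forall>x\<in>U. eventually (\<lambda>(x', y). x' = x \<longrightarrow> y \<in> U) uniformity)"
    for U :: "'a ell2 set" by (fact open_ell2_def)
qed

end

lemma ell2_partial_sum_le: "finite F \<Longrightarrow> (\<Sum>i\<in>F. (cmod (ell2_nth x i))\<^sup>2) \<le> (norm x)\<^sup>2"
  by (simp add: norm_ell2.rep_eq infsum_nonneg finite_sum_le_infsum ell2_nth_summable)

lemma ell2_boundedI:
  assumes "\<And>F. finite F \<Longrightarrow> (\<Sum>i\<in>F. (cmod (f i))\<^sup>2) \<le> b\<^sup>2" and b: "0 \<le> b"
  shows "(\<lambda>i. (cmod (f i))\<^sup>2) summable_on UNIV" and "norm (Abs_ell2 f) \<le> b"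
proof -
  show s: "(\<lambda>i. (cmod (f i))\<^sup>2) summable_on UNIV"
    by (rule nonneg_bdd_above_summable_on) (use assms in \<open>auto intro!: bdd_aboveI2\<close>)
  have "(\<Sum>\<^sub>\<infinity>i. (cmod (f i))\<^sup>2) \<le> b\<^sup>2"
    by (rule infsum_le_finite_sums[OF s]) (use assms in auto)
  then show "norm (Abs_ell2 f) \<le> b"
    using s b by (simp add: norm_ell2.rep_eq Abs_ell2_inverse real_le_lsqrt infsum_nonneg)
qed

lemma ell2_Cauchy_convergent:
  fixes X :: "nat \<Rightarrow> 'a ell2"
  assumes X: "Cauchy X"
  shows "convergent X"
proof -
  have coord: "cmod (ell2_nth x i) \<le> norm x" for x :: "'a ell2" and i
    by (rule power2_le_imp_le) (use ell2_partial_sum_le[of "{i}" x] in auto)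
  have "Cauchy (\<lambda>n. ell2_nth (X n) i)" for i
  proof (rule CauchyI)
    fix e :: real assume "0 < e"
    then obtain M where "\<forall>m\<ge>M. \<forall>n\<ge>M. norm (X m - X n) < e" using CauchyD[OF X] by blast
    moreover have "cmod (ell2_nth (X m) i - ell2_nth (X n) i) \<le> norm (X m - X n)" for m n
      using coord[of "X m - X n" i] by (simp add: minus_ell2.rep_eq)
    ultimately show "\<exists>M. \<forall>m\<ge>M. \<forall>n\<ge>M. cmod (ell2_nth (X m) i - ell2_nth (X n) i) < e"
      by (meson le_less_trans)
  qed
  then have "\<exists>l. (\<lambda>n. ell2_nth (X n) i) \<longlonglongrightarrow> l" for i
    using Cauchy_convergent convergent_def by blast
  then obtain f where f: "\<And>i. (\<lambda>n. ell2_nth (X n) i) \<longlonglongrightarrow> f i" by metis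
  have tail: "\<exists>M. \<forall>n\<ge>M. \<forall>F. finite F \<longrightarrow> (\<Sum>i\<in>F. (cmod (f i - ell2_nth (X n) i))\<^sup>2) \<le> e\<^sup>2"
    if e: "0 < e" for e
  proof -
    obtain M where M: "\<And>m n. m \<ge> M \<Longrightarrow> n \<ge> M \<Longrightarrow> norm (X m - X n) < e"
      using CauchyD[OF X e] by blast
    have "(\<Sum>i\<in>F. (cmod (f i - ell2_nth (X n) i))\<^sup>2) \<le> e\<^sup>2" if "n \<ge> M" "finite F" for n F
    proof (rule LIMSEQ_le_const2)
      show "(\<lambda>m. \<Sum>i\<in>F. (cmod (ell2_nth (X m) i - ell2_nth (X n) i))\<^sup>2)
          \<longlonglongrightarrow> (\<Sum>i\<in>F. (cmod (f i - ell2_nth (X n) i))\<^sup>2)"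
        by (intro tendsto_intros f)
      have "(\<Sum>i\<in>F. (cmod (ell2_nth (X m) i - ell2_nth (X n) i))\<^sup>2) \<le> e\<^sup>2" if "m \<ge> M" for m
      proof -
        have "(\<Sum>i\<in>F. (cmod (ell2_nth (X m - X n) i))\<^sup>2) \<le> (norm (X m - X n))\<^sup>2"
          using \<open>finite F\<close> by (rule ell2_partial_sum_le)
        also have "\<dots> \<le> e\<^sup>2" using M[OF that \<open>n \<ge> M\<close>] by (simp add: power_mono)
        finally show ?thesis by (simp add: minus_ell2.rep_eq)
      qed
      then show "\<exists>N. \<forall>m\<ge>N. (\<Sum>i\<in>F. (cmod (ell2_nth (X m) i - ell2_nth (X n) i))\<^sup>2) \<le> e\<^sup>2"
        by blast
    qed
    then show ?thesis by blast
  qed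
  obtain M where "\<And>F. finite F \<Longrightarrow> (\<Sum>i\<in>F. (cmod (f i - ell2_nth (X M) i))\<^sup>2) \<le> 1\<^sup>2"
    using tail[of 1] by auto
  from ell2_summable_add[OF ell2_boundedI(1)[OF this] ell2_nth_summable[of "X M"]]
  have fs: "(\<lambda>i. (cmod (f i))\<^sup>2) summable_on UNIV" by simp
  have "X \<longlonglongrightarrow> Abs_ell2 f"
  proof (rule LIMSEQ_I)
    fix e :: real assume e: "0 < e"
    obtain M where M: "\<And>n F. n \<ge> M \<Longrightarrow> finite F \<Longrightarrow>
        (\<Sum>i\<in>F. (cmod (f i - ell2_nth (X n) i))\<^sup>2) \<le> (e/2)\<^sup>2"
      using tail[of "e/2"] e by auto
    have "norm (X n - Abs_ell2 f) < e" if "n \<ge> M" for n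
    proof -
      have "Abs_ell2 f - X n = Abs_ell2 (ell2_nth (Abs_ell2 f - X n))"
        by (simp add: ell2_nth_inverse)
      also have "\<dots> = Abs_ell2 (\<lambda>i. f i - ell2_nth (X n) i)"
        using fs by (simp add: minus_ell2.rep_eq Abs_ell2_inverse)
      finally have "norm (Abs_ell2 f - X n) \<le> e/2"
        using ell2_boundedI(2)[OF M[OF that]] e by simp
      then show ?thesis using e by (simp add: norm_minus_commute)
    qed
    then show "\<exists>M. \<forall>n\<ge>M. norm (X n - Abs_ell2 f) < e" by blast
  qed
  then show "convergent X" by (auto simp: convergent_def)
qed

instance ell2 :: (type) chilbert_space
  by standard (rule ell2_Cauchy_convergent)

definition ket :: "'i \<Rightarrow> 'i ell2" where
  "ket k = Abs_ell2 (\<lambda>i. if i = k then 1 else 0)"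

lemma ell2_nth_ket: "ell2_nth (ket k) i = (if i = k then 1 else 0)"
proof -
  have "(\<lambda>i. (cmod (if i = k then 1 else 0))\<^sup>2) summable_on UNIV \<longleftrightarrow>
      (\<lambda>i. (cmod (if i = k then 1 else 0))\<^sup>2) summable_on {k}"
    by (rule summable_on_cong_neutral) auto
  then show ?thesis by (simp add: ket_def Abs_ell2_inverse)
qed

section \<open>Weighted shifts\<close>

text \<open>The operator \<open>e\<^sub>k \<mapsto> \<omega>\<^sub>k e\<^bsub>\<phi>(k)\<^esub>\<close>, for an injective map \<open>\<phi>\<close> of the index set and a bounded
  family of weights \<open>\<omega>\<close>.\<close>

definition weighted_shift :: "('i \<Rightarrow> 'i) \<Rightarrow> ('i \<Rightarrow> real) \<Rightarrow> 'i ell2 \<Rightarrow> 'i ell2" where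
  "weighted_shift \<phi> \<omega> x = Abs_ell2 (\<lambda>j. if j \<in> range \<phi>
     then complex_of_real (\<omega> (inv \<phi> j)) * ell2_nth x (inv \<phi> j) else 0)"

lemma weighted_shift_partial_sum_le:
  assumes inj: "inj \<phi>" and c: "\<And>k. \<bar>\<omega> k\<bar> \<le> c" and F: "finite F"
  shows "(\<Sum>j\<in>F. (cmod (if j \<in> range \<phi>
     then complex_of_real (\<omega> (inv \<phi> j)) * ell2_nth x (inv \<phi> j) else 0))\<^sup>2) \<le> (c * norm x)\<^sup>2"
proof -
  have c0: "0 \<le> c" using c[of undefined] by linarith
  have "(\<Sum>j\<in>F. (cmod (if j \<in> range \<phi>
     then complex_of_real (\<omega> (inv \<phi> j)) * ell2_nth x (inv \<phi> j) else 0))\<^sup>2)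
     = (\<Sum>j\<in>F \<inter> range \<phi>. (cmod (complex_of_real (\<omega> (inv \<phi> j)) * ell2_nth x (inv \<phi> j)))\<^sup>2)"
    using F by (intro sum.mono_neutral_cong_right) auto
  also have "\<dots> \<le> (\<Sum>j\<in>F \<inter> range \<phi>. c\<^sup>2 * (cmod (ell2_nth x (inv \<phi> j)))\<^sup>2)"
    by (intro sum_mono)
      (auto simp: norm_mult power_mult_distrib c abs_le_square_iff[symmetric] abs_of_nonneg[OF c0]
        intro!: mult_right_mono)
  also have "\<dots> = c\<^sup>2 * (\<Sum>j\<in>F \<inter> range \<phi>. (cmod (ell2_nth x (inv \<phi> j)))\<^sup>2)"
    by (simp add: sum_distrib_left)
  also have "(\<Sum>j\<in>F \<inter> range \<phi>. (cmod (ell2_nth x (inv \<phi> j)))\<^sup>2)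
      = (\<Sum>i\<in>inv \<phi> ` (F \<inter> range \<phi>). (cmod (ell2_nth x i))\<^sup>2)"
    by (subst sum.reindex) (auto intro: inj_on_subset[OF inj_on_inv_into[of "range \<phi>"]])
  also have "c\<^sup>2 * \<dots> \<le> c\<^sup>2 * (norm x)\<^sup>2"
    by (intro mult_left_mono ell2_partial_sum_le) (use F in auto)
  finally show ?thesis by (simp add: power_mult_distrib)
qed

lemma
  assumes inj: "inj \<phi>" and c: "\<And>k. \<bar>\<omega> k\<bar> \<le> c"
  shows ell2_nth_weighted_shift: "ell2_nth (weighted_shift \<phi> \<omega> x) j = (if j \<in> range \<phi>
     then complex_of_real (\<omega> (inv \<phi> j)) * ell2_nth x (inv \<phi> j) else 0)"
    and norm_weighted_shift_le: "norm (weighted_shift \<phi> \<omega> x) \<le> c * norm x"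
proof -
  have c0: "0 \<le> c * norm x" using c[of undefined] by (auto intro!: mult_nonneg_nonneg)
  note * = ell2_boundedI[OF weighted_shift_partial_sum_le[where \<phi>=\<phi> and \<omega>=\<omega> and c=c and x=x,
        OF assms] c0]
  show "ell2_nth (weighted_shift \<phi> \<omega> x) j = (if j \<in> range \<phi>
     then complex_of_real (\<omega> (inv \<phi> j)) * ell2_nth x (inv \<phi> j) else 0)"
    unfolding weighted_shift_def using *(1) by (subst Abs_ell2_inverse) auto
  show "norm (weighted_shift \<phi> \<omega> x) \<le> c * norm x"
    unfolding weighted_shift_def by (rule *(2))
qed

lemma weighted_shift_ket:
  assumes "inj \<phi>" and "\<And>k. \<bar>\<omega> k\<bar> \<le> c"
  shows "weighted_shift \<phi> \<omega> (ket k) = complex_of_real (\<omega> k) *\<^sub>C ket (\<phi> k)"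
  by (rule ell2_nth_inject[THEN iffD1], rule ext)
    (auto simp: ell2_nth_weighted_shift[OF assms] scaleC_ell2.rep_eq ell2_nth_ket
      inv_f_f[OF assms(1)])

lemma bounded_clinear_weighted_shift:
  assumes "inj \<phi>" and "\<And>k. \<bar>\<omega> k\<bar> \<le> c"
  shows "bounded_clinear (weighted_shift \<phi> \<omega>)"
  unfolding bounded_clinear_def
proof (intro conjI allI bounded_linear_intro[where K=c])
  note nth = ell2_nth_weighted_shift[OF assms]
  fix x y :: "'a ell2" and r :: real and d :: complex
  show "weighted_shift \<phi> \<omega> (x + y) = weighted_shift \<phi> \<omega> x + weighted_shift \<phi> \<omega> y"
    by (rule ell2_nth_inject[THEN iffD1], rule ext)
      (auto simp: nth plus_ell2.rep_eq algebra_simps)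
  show "weighted_shift \<phi> \<omega> (r *\<^sub>R x) = r *\<^sub>R weighted_shift \<phi> \<omega> x"
    by (rule ell2_nth_inject[THEN iffD1], rule ext)
      (auto simp: nth scaleR_ell2.rep_eq algebra_simps)
  show "weighted_shift \<phi> \<omega> (d *\<^sub>C x) = d *\<^sub>C weighted_shift \<phi> \<omega> x"
    by (rule ell2_nth_inject[THEN iffD1], rule ext)
      (auto simp: nth scaleC_ell2.rep_eq algebra_simps)
  show "norm (weighted_shift \<phi> \<omega> x) \<le> norm x * c"
    using norm_weighted_shift_le[OF assms] by (simp add: mult.commute)
qed

definition unilateral_shift :: "(nat \<Rightarrow> real) \<Rightarrow> nat ell2 \<Rightarrow> nat ell2" where
  "unilateral_shift \<omega> = weighted_shift Suc \<omega>"

definition two_variable_shift ::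
  "(nat \<times> nat \<Rightarrow> real) \<Rightarrow> (nat \<times> nat \<Rightarrow> real) \<Rightarrow>
    ((nat \<times> nat) ell2 \<Rightarrow> (nat \<times> nat) ell2) \<times> ((nat \<times> nat) ell2 \<Rightarrow> (nat \<times> nat) ell2)" where
  "two_variable_shift \<alpha> \<beta> =
    (weighted_shift (\<lambda>(k1, k2). (Suc k1, k2)) \<alpha>, weighted_shift (\<lambda>(k1, k2). (k1, Suc k2)) \<beta>)"

definition is_berger_measure :: "(nat \<Rightarrow> real) \<Rightarrow> real measure \<Rightarrow> bool" where
  "is_berger_measure \<omega> \<xi> \<longleftrightarrow> prob_space \<xi> \<and> sets \<xi> = sets borel \<and>
    (AE s in \<xi>. 0 \<le> s \<and> s \<le> (onorm (unilateral_shift \<omega>))\<^sup>2) \<and>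
    (\<forall>k. (\<Prod>i<k. (\<omega> i)\<^sup>2) = (\<integral>s. s ^ k \<partial>\<xi>))"

section \<open>Subnormal and hyponormal operators and pairs\<close>

definition normal_operator :: "('a::complex_inner \<Rightarrow> 'a) \<Rightarrow> bool" where
  "normal_operator N \<longleftrightarrow> bounded_clinear N \<and> N \<circ> adj N = adj N \<circ> N"

definition isometric_embedding :: "('a::complex_inner \<Rightarrow> 'b::complex_inner) \<Rightarrow> bool" where
  "isometric_embedding V \<longleftrightarrow> bounded_clinear V \<and> (\<forall>x. norm (V x) = norm x)"

text \<open>Quantification over Hilbert spaces is quantification over types, which cannot be done inside a
  formula. The extension space is therefore a type parameter \<open>'k\<close>: an operator is subnormal in
  the usual sense iff \<open>subnormal TYPE('k)\<close> holds for some complex Hilbert space \<open>'k\<close>. The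
  space \<open>'h\<close> is identified with a closed subspace of \<open>'k\<close> through an isometric embedding \<open>V\<close>;
  the intertwining relation says that the range of \<open>V\<close> is invariant and that the restriction to it
  is the given operator.\<close>

definition subnormal :: "'k::chilbert_space itself \<Rightarrow> ('h::chilbert_space \<Rightarrow> 'h) \<Rightarrow> bool" where
  "subnormal _ T \<longleftrightarrow> bounded_clinear T \<and>
    (\<exists>(V :: 'h \<Rightarrow> 'k) N. isometric_embedding V \<and> normal_operator N \<and> (\<forall>x. N (V x) = V (T x)))"

definition subnormal_pair ::
  "'k::chilbert_space itself \<Rightarrow> ('h::chilbert_space \<Rightarrow> 'h) \<times> ('h \<Rightarrow> 'h) \<Rightarrow> bool" where
  "subnormal_pair _ = (\<lambda>(T1, T2). bounded_clinear T1 \<and> bounded_clinear T2 \<and>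
    (\<exists>(V :: 'h \<Rightarrow> 'k) N1 N2. isometric_embedding V \<and>
      normal_operator N1 \<and> normal_operator N2 \<and> N1 \<circ> N2 = N2 \<circ> N1 \<and>
      (\<forall>x. N1 (V x) = V (T1 x)) \<and> (\<forall>x. N2 (V x) = V (T2 x))))"

definition commutator :: "('h::complex_inner \<Rightarrow> 'h) \<Rightarrow> ('h \<Rightarrow> 'h) \<Rightarrow> 'h \<Rightarrow> 'h" where
  "commutator S T = (\<lambda>x. S (T x) - T (S x))"

text \<open>Positivity of the operator matrix with rows \<open>(A, B)\<close> and \<open>(C, D)\<close> on \<open>H \<oplus> H\<close>; the order on
  \<open>complex\<close> is the one in which \<open>0 \<le> z\<close> means that \<open>z\<close> is real and nonnegative.\<close>

definition positive_operator_matrix ::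
  "('h::complex_inner \<Rightarrow> 'h) \<Rightarrow> ('h \<Rightarrow> 'h) \<Rightarrow> ('h \<Rightarrow> 'h) \<Rightarrow> ('h \<Rightarrow> 'h) \<Rightarrow> bool" where
  "positive_operator_matrix A B C D \<longleftrightarrow>
    (\<forall>u v. 0 \<le> cinner (A u + B v) u + cinner (C u + D v) v)"

definition jointly_hyponormal :: "('h::complex_inner \<Rightarrow> 'h) \<times> ('h \<Rightarrow> 'h) \<Rightarrow> bool" where
  "jointly_hyponormal = (\<lambda>(T1, T2). positive_operator_matrix
    (commutator (adj T1) T1) (commutator (adj T2) T1)
    (commutator (adj T1) T2) (commutator (adj T2) T2))"

definition H_0 :: "'k::chilbert_space itself \<Rightarrow> (('h::chilbert_space \<Rightarrow> 'h) \<times> ('h \<Rightarrow> 'h)) set" where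
  "H_0 K = {(T1, T2). subnormal K T1 \<and> subnormal K T2 \<and> T1 \<circ> T2 = T2 \<circ> T1}"

definition H_1 :: "'k::chilbert_space itself \<Rightarrow> (('h::chilbert_space \<Rightarrow> 'h) \<times> ('h \<Rightarrow> 'h)) set" where
  "H_1 K = {T \<in> H_0 K. jointly_hyponormal T}"

definition H_infinity ::
  "'k::chilbert_space itself \<Rightarrow> (('h::chilbert_space \<Rightarrow> 'h) \<times> ('h \<Rightarrow> 'h)) set" where
  "H_infinity K = {T. subnormal_pair K T}"

section \<open>The weights of the family\<close>

definition weight_alpha :: "real \<Rightarrow> real \<Rightarrow> nat \<times> nat \<Rightarrow> real" where
  "weight_alpha x a = (\<lambda>(k1, k2). if k1 = 0 then if k2 = 0 then x else a else 1)"

definition weight_beta :: "(nat \<Rightarrow> real) \<Rightarrow> real \<Rightarrow> real \<Rightarrow> real \<Rightarrow> nat \<times> nat \<Rightarrow> real" where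
  "weight_beta \<beta> x a y =
    (\<lambda>(k1, k2). if k2 = 0 then if k1 = 0 then y else a * y / x else \<beta> k2)"

end

theory Submission
  imports Defs "HOL-Computational_Algebra.Polynomial"
begin

text \<open>Let \<open>\<nu>\<^sub>l\<^sup>2 = (ln 3)\<^sup>-\<^sup>1 \<integral> t\<^bsup>l-1\<^esup> dt\<close> over \<open>[1/2, 3/2]\<close>. The weights of the pair are quotients of
  \<open>G(k\<^sub>1, k\<^sub>2) = g(k\<^sub>1, k\<^sub>2) \<nu>\<^bsub>k\<^sub>2\<^esub>\<close>, where \<open>g\<close> is constant on each of the four regions cut out by the axes
  and decreases along the lattice. In the orthonormal polynomials of the measure \<open>2 dr/r\<close> on
  \<open>[sqrt(1/2), sqrt(3/2)]\<close>, multiplication by \<open>r\<close> is a bounded self-adjoint Jacobi matrix \<open>J\<close> with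
  \<open>\<parallel>J\<^sup>l e\<parallel> = \<nu>\<^sub>l\<close>. The bilateral shift tensored with \<open>J\<^sup>n\<close>, plus a summand on which the operator is 0
  to carry the atom at 0 of the Berger measures, is a normal extension of \<open>T\<^sub>1\<^sup>m T\<^sub>2\<^sup>n\<close>, for all \<open>m\<close> and \<open>n\<close>.

  Joint hyponormality reduces to 2 by 2 determinants, of which only the one at the origin is not
  trivially nonnegative; it gives the first term of \<open>M\<close>.

  If \<open>(N\<^sub>1, N\<^sub>2)\<close> were a commuting normal extension, the component \<open>f\<close> of \<open>e\<^sub>0\<close> in the kernel of \<open>N\<^sub>1\<close> would
  satisfy \<open>\<parallel>f\<parallel>\<^sup>2 = 1 - x\<^sup>2\<close> and \<open>\<parallel>N\<^sub>2\<^sup>l f\<parallel>\<^sup>2 = (1 - a\<^sup>2) y\<^sup>2 \<integral> t\<^bsup>l-1\<^esup> dt\<close> for \<open>l \<ge> 1\<close>, so its mass off 0 would be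
  \<open>(1 - a\<^sup>2) y\<^sup>2 ln 3\<close>, which is at most \<open>1 - x\<^sup>2\<close> only if \<open>y \<le> s\<close>.\<close>

section \<open>Operators on complex Hilbert spaces\<close>

lemma cinner_self_norm: "cinner x x = complex_of_real ((norm x)\<^sup>2)"
proof -
  have "Im (cinner x x) = 0" using cinner_commute[of x x] by (metis Reals_cnj_iff complex_is_Real_iff)
  then show ?thesis
    by (simp add: complex_eq_iff power2_norm_eq_inner inner_eq_Re_cinner)
qed

lemma cinner_add_right: "cinner x (y + z) = cinner x y + cinner x z"
  by (metis cinner_add_left cinner_commute complex_cnj_add)

lemma cinner_scaleC_right: "cinner x (c *\<^sub>C y) = cnj c * cinner x y"
  by (metis cinner_commute cinner_scaleC_left complex_cnj_mult)

lemma cinner_diff_left: "cinner (x - y) z = cinner x z - cinner y z"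
  using cinner_add_left[of "x - y" y z] by simp

lemma cinner_diff_right: "cinner x (y - z) = cinner x y - cinner x z"
  using cinner_add_right[of x "y - z" z] by simp

lemma cinner_zero_left [simp]: "cinner 0 x = 0"
  using cinner_diff_left[of x x x] by simp

lemma cinner_zero_right [simp]: "cinner x 0 = 0"
  using cinner_diff_right[of x x x] by simp

lemma scaleC_zero_right [simp]: "c *\<^sub>C (0::'a::complex_inner) = 0"
  using scaleC_add_right[of c 0 "0::'a"] by simp

lemma scaleC_zero_left [simp]: "0 *\<^sub>C x = (0::'a::complex_inner)"
  using scaleC_of_real[of 0 x] by simp

lemma norm_scaleC: "norm (c *\<^sub>C x) = cmod c * norm x"
proof -
  have "cinner (c *\<^sub>C x) (c *\<^sub>C x) = (c * cnj c) * cinner x x"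
    by (simp add: cinner_scaleC_left cinner_scaleC_right mult.assoc)
  then have "complex_of_real ((norm (c *\<^sub>C x))\<^sup>2) = complex_of_real ((cmod c)\<^sup>2 * (norm x)\<^sup>2)"
    by (simp only: cinner_self_norm complex_norm_square of_real_mult)
  then have "(norm (c *\<^sub>C x))\<^sup>2 = (cmod c * norm x)\<^sup>2"
    by (simp only: of_real_eq_iff power_mult_distrib)
  then show ?thesis by simp
qed

lemma is_adjoint_sym: "is_adjoint T S \<Longrightarrow> is_adjoint S T"
  unfolding is_adjoint_def by (metis cinner_commute)

lemma is_adjoint_comp: "is_adjoint S S' \<Longrightarrow> is_adjoint T T' \<Longrightarrow> is_adjoint (S \<circ> T) (T' \<circ> S')"
  by (simp add: is_adjoint_def)

lemma is_adjoint_id: "is_adjoint id id"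
  by (simp add: is_adjoint_def)

lemma is_adjoint_funpow:
  assumes "is_adjoint T S"
  shows "is_adjoint (T ^^ n) (S ^^ n)"
proof (induction n)
  case (Suc n)
  from is_adjoint_comp[OF assms Suc.IH] show ?case
    by (simp only: funpow.simps(2)[of n T] funpow_Suc_right[of n S])
qed (simp add: is_adjoint_id[unfolded id_def] id_def)

lemma bounded_clinear_comp:
  "bounded_clinear S \<Longrightarrow> bounded_clinear T \<Longrightarrow> bounded_clinear (S \<circ> T)"
  by (auto simp: bounded_clinear_def o_def intro: bounded_linear_compose)

lemma bounded_clinear_id: "bounded_clinear id"
  by (simp add: bounded_clinear_def bounded_linear_ident id_def)

lemma bounded_clinear_funpow:
  fixes T :: "'a::complex_inner \<Rightarrow> 'a"
  assumes "bounded_clinear T"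
  shows "bounded_clinear (T ^^ n)"
  by (induction n) (simp_all add: assms bounded_clinear_id[unfolded id_def] id_def bounded_clinear_comp[unfolded o_def])

lemma bounded_clinear_plus:
  "bounded_clinear S \<Longrightarrow> bounded_clinear T \<Longrightarrow> bounded_clinear (\<lambda>x. S x + T x)"
  by (auto simp: bounded_clinear_def bounded_linear_add scaleC_add_right)

lemma bounded_clinear_adj:
  fixes T :: "'a::chilbert_space \<Rightarrow> 'a"
  assumes T: "bounded_clinear T"
  shows "bounded_clinear (adj T)"
proof -
  note A = is_adjoint_adj[OF T, unfolded is_adjoint_def, rule_format]
  have eqI: "u = v" if "\<And>x. cinner x u = cinner x v" for u v :: 'a
  proof -
    have "cinner (u - v) (u - v) = 0" using that by (simp add: cinner_diff_right)
    then show ?thesis by (simp add: cinner_self_norm)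
  qed
  obtain K where K: "\<And>x. norm (T x) \<le> norm x * K"
    using T bounded_linear.bounded unfolding bounded_clinear_def by blast
  have add: "adj T (x + y) = adj T x + adj T y" for x y
    by (rule eqI) (simp add: A[symmetric] cinner_add_right)
  have scale: "adj T (c *\<^sub>C x) = c *\<^sub>C adj T x" for c x
    by (rule eqI) (simp add: A[symmetric] cinner_scaleC_right)
  have "norm (adj T y) \<le> norm y * K" for y
  proof -
    have "(norm (adj T y))\<^sup>2 = inner (T (adj T y)) y"
      by (simp add: inner_eq_Re_cinner A power2_norm_eq_inner)
    also have "\<dots> \<le> norm (T (adj T y)) * norm y" by (rule norm_cauchy_schwarz)
    also have "\<dots> \<le> norm (adj T y) * K * norm y" by (intro mult_right_mono K) simp
    finally have "norm (adj T y) * norm (adj T y) \<le> norm (adj T y) * (norm y * K)"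
      by (simp add: power2_eq_square mult_ac)
    moreover have "0 \<le> norm y * K" using K[of y] norm_ge_zero[of "T y"] by linarith
    ultimately show ?thesis by (cases "norm (adj T y) = 0") (auto simp: mult_le_cancel_left)
  qed
  moreover have "adj T (r *\<^sub>R x) = r *\<^sub>R adj T x" for r x
    using scale[of "complex_of_real r" x] by (simp add: scaleC_of_real)
  ultimately show ?thesis
    unfolding bounded_clinear_def using add scale by (auto intro!: bounded_linear_intro[where K=K])
qed

section \<open>Coordinates, basis vectors and adjoints in \<open>ell2\<close>\<close>

lemma ell2_eqI: "(\<And>i. ell2_nth x i = ell2_nth y i) \<Longrightarrow> x = y"
  by (metis ell2_nth_inject ext)

lemma has_sum_cinner_ell2: "((\<lambda>i. ell2_nth x i * cnj (ell2_nth y i)) has_sum cinner x y) UNIV"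
  unfolding cinner_ell2.rep_eq
  by (intro has_sum_infsum ell2_summable_cinner ell2_nth_summable)

lemma has_sum_norm_ell2: "((\<lambda>i. (cmod (ell2_nth x i))\<^sup>2) has_sum (norm x)\<^sup>2) UNIV"
proof -
  have "(norm x)\<^sup>2 = (\<Sum>\<^sub>\<infinity>i. (cmod (ell2_nth x i))\<^sup>2)"
    by (simp add: norm_ell2.rep_eq infsum_nonneg)
  then show ?thesis using has_sum_infsum[OF ell2_nth_summable[of x]] by simp
qed

lemma cinner_ket: "cinner x (ket i) = ell2_nth x i"
proof -
  have "((\<lambda>j. ell2_nth x j * cnj (ell2_nth (ket i) j)) has_sum ell2_nth x i) {i}"
    using has_sum_finite[of "{i}" "\<lambda>j. ell2_nth x j * cnj (ell2_nth (ket i) j)"]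
    by (simp add: ell2_nth_ket)
  then have "((\<lambda>j. ell2_nth x j * cnj (ell2_nth (ket i) j)) has_sum ell2_nth x i) UNIV"
    by (rule has_sum_cong_neutral[THEN iffD1, rotated -1]) (auto simp: ell2_nth_ket)
  then show ?thesis using has_sum_cinner_ell2 has_sum_unique by blast
qed

lemma norm_ket [simp]: "norm (ket i) = 1"
proof -
  have "complex_of_real ((norm (ket i))\<^sup>2) = 1"
    by (simp only: cinner_self_norm[symmetric] cinner_ket) (simp add: ell2_nth_ket)
  then have "(norm (ket i))\<^sup>2 = 1\<^sup>2" by (metis of_real_eq_1_iff one_power2)
  then show ?thesis by (metis norm_ge_zero power2_eq_imp_eq zero_le_one)
qed

lemma ell2_nth_adj_weighted_shift:
  assumes "inj \<phi>" and "\<And>k. \<bar>\<omega> k\<bar> \<le> c"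
  shows "ell2_nth (adj (weighted_shift \<phi> \<omega>) x) i = complex_of_real (\<omega> i) * ell2_nth x (\<phi> i)"
proof -
  have "cinner (weighted_shift \<phi> \<omega> (ket i)) x = cinner (ket i) (adj (weighted_shift \<phi> \<omega>) x)"
    using is_adjoint_adj[OF bounded_clinear_weighted_shift[OF assms]] by (simp add: is_adjoint_def)
  then have "complex_of_real (\<omega> i) * cnj (cinner x (ket (\<phi> i)))
      = cnj (cinner (adj (weighted_shift \<phi> \<omega>) x) (ket i))"
    by (simp add: weighted_shift_ket[OF assms] cinner_scaleC_left flip: cinner_commute)
  from arg_cong[OF this, of cnj] show ?thesis by (simp add: cinner_ket)
qed

lemma weighted_shift_comp:
  assumes "inj \<phi>" "\<And>k. \<bar>\<omega> k\<bar> \<le> c" "inj \<psi>" "\<And>k. \<bar>\<tau> k\<bar> \<le> d"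
  shows "weighted_shift \<phi> \<omega> \<circ> weighted_shift \<psi> \<tau>
    = weighted_shift (\<phi> \<circ> \<psi>) (\<lambda>k. \<omega> (\<psi> k) * \<tau> k)"
proof (rule ext, rule ell2_eqI)
  fix x j
  have inj: "inj (\<phi> \<circ> \<psi>)" using assms by (simp add: inj_compose)
  have bd: "\<bar>\<omega> (\<psi> k) * \<tau> k\<bar> \<le> c * d" for k
    unfolding abs_mult using assms(2)[of "\<psi> k"] assms(4)[of k]
    by (intro mult_mono) (auto intro: order_trans[OF abs_ge_zero])
  note n = ell2_nth_weighted_shift
  show "ell2_nth ((weighted_shift \<phi> \<omega> \<circ> weighted_shift \<psi> \<tau>) x) j
    = ell2_nth (weighted_shift (\<phi> \<circ> \<psi>) (\<lambda>k. \<omega> (\<psi> k) * \<tau> k) x) j"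
  proof (cases "j \<in> range (\<phi> \<circ> \<psi>)")
    case True
    then obtain k where k: "j = \<phi> (\<psi> k)" by auto
    have 1: "inv (\<phi> \<circ> \<psi>) j = k" using k inj by (metis inv_f_f o_apply)
    have 2: "inv \<phi> j = \<psi> k" using k assms(1) by simp
    have 3: "j \<in> range \<phi>" using k by simp
    show ?thesis
      unfolding o_apply[of "weighted_shift \<phi> \<omega>"] n[OF inj bd] n[OF assms(1,2)] n[OF assms(3,4)] 1 2
      using True 3 assms(3) by simp
  next
    case False
    have "inv \<phi> j \<notin> range \<psi>" if "j \<in> range \<phi>"
      using False that assms(1) by (auto simp: image_iff)
    then show ?thesis
      unfolding o_apply[of "weighted_shift \<phi> \<omega>"] n[OF inj bd] n[OF assms(1,2)] n[OF assms(3,4)]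
      using False by simp
  qed
qed

section \<open>Normal operators on fibred spaces\<close>

text \<open>\<open>slice\<close> and \<open>assemble\<close> identify
  \<open>('p \<times> 'j) ell2\<close> with the Hilbert sum of copies of \<open>'j ell2\<close>
  indexed by \<open>'p\<close>. \<open>assemble f\<close> has this meaning only when the squared
  norms of the \<open>f p\<close> are summable.\<close>

definition slice :: "'p \<Rightarrow> ('p \<times> 'j) ell2 \<Rightarrow> 'j ell2" where
  "slice p z = Abs_ell2 (\<lambda>j. ell2_nth z (p, j))"

definition assemble :: "('p \<Rightarrow> 'j ell2) \<Rightarrow> ('p \<times> 'j) ell2" where
  "assemble f = Abs_ell2 (\<lambda>(p, j). ell2_nth (f p) j)"

lemma ell2_nth_slice: "ell2_nth (slice p z) j = ell2_nth z (p, j)"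
proof -
  have "(\<lambda>j. (cmod (ell2_nth z (p, j)))\<^sup>2) summable_on UNIV"
    using summable_on_SigmaD1[of "\<lambda>p j. (cmod (ell2_nth z (p, j)))\<^sup>2" UNIV "\<lambda>_. UNIV" p]
      ell2_nth_summable[of z] by (simp add: case_prod_unfold)
  then show ?thesis by (simp add: slice_def Abs_ell2_inverse)
qed

lemma ell2_slice_eqI: "(\<And>p. slice p z = slice p w) \<Longrightarrow> z = w"
  by (rule ell2_eqI) (metis ell2_nth_slice surj_pair)

lemma slice_assemble:
  assumes "(\<lambda>p. (norm (f p))\<^sup>2) summable_on UNIV"
  shows "slice p (assemble f) = f p"
proof -
  have "(\<lambda>pj. (cmod (ell2_nth (f (fst pj)) (snd pj)))\<^sup>2) summable_on (UNIV \<times> UNIV)"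
    by (rule summable_on_SigmaI[OF _ assms]) (use has_sum_norm_ell2 in auto)
  then have "(\<lambda>pj. (cmod (case pj of (p, j) \<Rightarrow> ell2_nth (f p) j))\<^sup>2) summable_on UNIV"
    by (simp add: case_prod_unfold)
  then have "ell2_nth (assemble f) (p, j) = ell2_nth (f p) j" for p j
    by (simp add: assemble_def Abs_ell2_inverse)
  then show ?thesis by (intro ell2_eqI) (simp add: ell2_nth_slice)
qed

lemma has_sum_cinner_slice: "((\<lambda>p. cinner (slice p z) (slice p w)) has_sum cinner z w) UNIV"
proof (rule has_sum_SigmaD)
  show "((\<lambda>i. ell2_nth z i * cnj (ell2_nth w i)) has_sum cinner z w) (UNIV \<times> UNIV)"
    using has_sum_cinner_ell2 by simp
  show "((\<lambda>j. ell2_nth z (p, j) * cnj (ell2_nth w (p, j))) has_sum cinner (slice p z) (slice p w)) UNIV"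
    for p using has_sum_cinner_ell2[of "slice p z" "slice p w"] by (simp add: ell2_nth_slice)
qed

lemma has_sum_norm_slice: "((\<lambda>p. (norm (slice p z))\<^sup>2) has_sum (norm z)\<^sup>2) UNIV"
proof (rule has_sum_SigmaD)
  show "((\<lambda>i. (cmod (ell2_nth z i))\<^sup>2) has_sum (norm z)\<^sup>2) (UNIV \<times> UNIV)"
    using has_sum_norm_ell2[of z] by simp
  show "((\<lambda>j. (cmod (ell2_nth z (p, j)))\<^sup>2) has_sum (norm (slice p z))\<^sup>2) UNIV"
    for p using has_sum_norm_ell2[of "slice p z"] by (simp add: ell2_nth_slice)
qed

lemma slice_add: "slice p (z + w) = slice p z + slice p w"
  and slice_scaleC: "slice p (c *\<^sub>C z) = c *\<^sub>C slice p z"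
  and slice_scaleR: "slice p (r *\<^sub>R z) = r *\<^sub>R slice p z"
  by (rule ell2_eqI; simp add: ell2_nth_slice plus_ell2.rep_eq scaleC_ell2.rep_eq scaleR_ell2.rep_eq)+

text \<open>A permutation of the fibres tensored with \<open>R\<close>. Fibre p of the image is read
  from fibre \<open>\<sigma> p\<close>, so moving fibres forward along \<sigma> takes
  \<open>inv \<sigma>\<close>.\<close>

definition fibre_map :: "('p \<Rightarrow> 'p) \<Rightarrow> ('j ell2 \<Rightarrow> 'j ell2) \<Rightarrow> ('p \<times> 'j) ell2 \<Rightarrow> ('p \<times> 'j) ell2" where
  "fibre_map \<sigma> R z = assemble (\<lambda>p. R (slice (\<sigma> p) z))"

lemma
  assumes \<sigma>: "bij \<sigma>" and R: "bounded_clinear R"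
  shows slice_fibre_map: "slice p (fibre_map \<sigma> R z) = R (slice (\<sigma> p) z)"
    and bounded_clinear_fibre_map: "bounded_clinear (fibre_map \<sigma> R)"
proof -
  obtain K where K: "\<And>x. norm (R x) \<le> norm x * K" 
    using R bounded_linear.bounded unfolding bounded_clinear_def by blast
  have RK: "(norm (R x))\<^sup>2 \<le> K\<^sup>2 * (norm x)\<^sup>2" for x
    using power_mono[OF K, of x 2] by (simp add: power_mult_distrib mult.commute)
  have sh: "((\<lambda>p. K\<^sup>2 * (norm (slice (\<sigma> p) z))\<^sup>2) has_sum K\<^sup>2 * (norm z)\<^sup>2) UNIV" for z
    using has_sum_cmult_right[OF has_sum_reindex_bij_betw[OF \<sigma>, THEN iffD2, OF has_sum_norm_slice[of z]]] .
  have "(\<lambda>p. (norm (R (slice (\<sigma> p) z)))\<^sup>2) summable_on UNIV" for z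
    by (rule summable_on_comparison_test[OF has_sum_imp_summable[OF sh[of z]]]) (auto simp: RK)
  then show sl: "slice p (fibre_map \<sigma> R z) = R (slice (\<sigma> p) z)" for p z
    unfolding fibre_map_def by (rule slice_assemble)
  have "(norm (fibre_map \<sigma> R z))\<^sup>2 \<le> K\<^sup>2 * (norm z)\<^sup>2" for z
    by (rule has_sum_mono[OF has_sum_norm_slice sh]) (simp add: sl RK)
  then have "norm (fibre_map \<sigma> R z) \<le> norm z * \<bar>K\<bar>" for z
    by (metis power_mult_distrib mult.commute power2_abs power2_le_imp_le abs_ge_zero norm_ge_zero mult_nonneg_nonneg)
  moreover have Radd: "R (x + y) = R x + R y" and Rsc: "R (c *\<^sub>C x) = c *\<^sub>C R x"
    and Rsr: "R (r *\<^sub>R x) = r *\<^sub>R R x" for x y c r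
    using R by (auto simp: bounded_clinear_def linear_simps)
  ultimately show "bounded_clinear (fibre_map \<sigma> R)"
    unfolding bounded_clinear_def
    by (auto intro!: bounded_linear_intro[where K="\<bar>K\<bar>"] ell2_slice_eqI
        simp: sl slice_add slice_scaleC slice_scaleR)
qed

lemma is_adjoint_fibre_map:
  assumes \<sigma>: "bij \<sigma>" and R: "bounded_clinear R" and S: "bounded_clinear S" and RS: "is_adjoint R S"
  shows "is_adjoint (fibre_map (inv \<sigma>) R) (fibre_map \<sigma> S)"
  unfolding is_adjoint_def
proof (intro allI)
  fix z w
  have "((\<lambda>p. cinner (R (slice (inv \<sigma> p) z)) (slice p w)) has_sum cinner (fibre_map (inv \<sigma>) R z) w) UNIV"
    using has_sum_cinner_slice[of "fibre_map (inv \<sigma>) R z" w]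
    by (simp add: slice_fibre_map[OF bij_imp_bij_inv[OF \<sigma>] R])
  then have "((\<lambda>p. cinner (R (slice (inv \<sigma> (\<sigma> p)) z)) (slice (\<sigma> p) w))
      has_sum cinner (fibre_map (inv \<sigma>) R z) w) UNIV"
    by (rule has_sum_reindex_bij_betw[OF \<sigma>, THEN iffD2])
  then have "((\<lambda>p. cinner (slice p z) (S (slice (\<sigma> p) w))) has_sum cinner (fibre_map (inv \<sigma>) R z) w) UNIV"
    using RS \<sigma> by (simp add: is_adjoint_def bij_is_inj)
  then show "cinner (fibre_map (inv \<sigma>) R z) w = cinner z (fibre_map \<sigma> S w)"
    using has_sum_cinner_slice[of z "fibre_map \<sigma> S w"] has_sum_unique
    by (simp add: slice_fibre_map[OF \<sigma> S]) blast
qed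

text \<open>The permutation is unitary and commutes with the fibrewise self-adjoint
  \<open>R\<close>; in either order the operator and its adjoint compose to
  \<open>R \<circ> R\<close> on every fibre.\<close>

lemma normal_operator_fibre_map:
  fixes R :: "'j ell2 \<Rightarrow> 'j ell2"
  assumes \<sigma>: "bij \<sigma>" and R: "bounded_clinear R" and RR: "is_adjoint R R"
  shows "normal_operator (fibre_map (inv \<sigma>) R)"
proof -
  have "adj (fibre_map (inv \<sigma>) R) = fibre_map \<sigma> R"
    by (intro adj_eqI is_adjoint_fibre_map assms)
  moreover have "fibre_map (inv \<sigma>) R \<circ> fibre_map \<sigma> R = fibre_map \<sigma> R \<circ> fibre_map (inv \<sigma>) R"
    using \<sigma> by (intro ext ell2_slice_eqI)
      (simp add: slice_fibre_map[OF \<sigma> R] slice_fibre_map[OF bij_imp_bij_inv[OF \<sigma>] R]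
        bij_is_inj bij_is_surj surj_f_inv_f)
  ultimately show ?thesis
    by (simp add: normal_operator_def bounded_clinear_fibre_map bij_imp_bij_inv \<sigma> R)
qed

text \<open>The embedding sends \<open>ket i\<close> to \<open>u i\<close> placed in fibre
  \<open>\<iota> i\<close>. Distinct indices use distinct fibres, so the images are orthonormal
  whatever the inner products between the \<open>u i\<close>. Translating fibres by \<sigma> and
  applying \<open>R\<close> reproduces the weights, by \<open>Ru\<close>.\<close>

lemma subnormal_weighted_shiftI:
  fixes \<phi> :: "'i \<Rightarrow> 'i" and \<iota> :: "'i \<Rightarrow> 'p" and u :: "'i \<Rightarrow> 'j ell2"
  assumes \<phi>: "inj \<phi>" and \<omega>: "\<And>k. \<bar>\<omega> k\<bar> \<le> c"
    and \<sigma>: "bij \<sigma>" and \<iota>: "inj \<iota>" and \<sigma>\<iota>: "\<And>i. \<sigma> (\<iota> i) = \<iota> (\<phi> i)"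
    and R: "bounded_clinear R" and RR: "is_adjoint R R"
    and u: "\<And>i. norm (u i) = 1" and Ru: "\<And>i. R (u i) = \<omega> i *\<^sub>R u (\<phi> i)"
  shows "subnormal TYPE(('p \<times> 'j) ell2) (weighted_shift \<phi> \<omega>)"
proof -
  define F where "F x p = (if p \<in> range \<iota> then ell2_nth x (inv \<iota> p) *\<^sub>C u (inv \<iota> p) else 0)" for x p
  define V where "V x = assemble (F x)" for x
  have F\<iota>: "F x (\<iota> i) = ell2_nth x i *\<^sub>C u i" for x i by (simp add: F_def \<iota>)
  have F0: "F x p = 0" if "p \<notin> range \<iota>" for x p using that by (simp add: F_def)
  have hs: "((\<lambda>p. (norm (F x p))\<^sup>2) has_sum (norm x)\<^sup>2) UNIV" for x
  proof -
    have "((\<lambda>p. (norm (F x p))\<^sup>2) has_sum (norm x)\<^sup>2) (range \<iota>)"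
      unfolding has_sum_reindex[OF \<iota>] using has_sum_norm_ell2[of x]
      by (simp add: F\<iota> norm_scaleC u o_def)
    then show ?thesis
      by (rule has_sum_cong_neutral[THEN iffD1, rotated -1]) (auto simp: F0)
  qed
  have sl: "slice p (V x) = F x p" for x p
    unfolding V_def by (rule slice_assemble[OF has_sum_imp_summable[OF hs]])
  have nV: "norm (V x) = norm x" for x
    using has_sum_unique[OF hs[of x] has_sum_norm_slice[of "V x", unfolded sl]] by simp
  have "V (x + y) = V x + V y" "V (d *\<^sub>C x) = d *\<^sub>C V x" for x y d
    by (rule ell2_slice_eqI; simp add: sl slice_add slice_scaleC F_def plus_ell2.rep_eq
        scaleC_ell2.rep_eq scaleC_add_left scaleC_scaleC)+
  moreover from this(2) have "V (r *\<^sub>R x) = r *\<^sub>R V x" for r x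
    by (metis scaleC_of_real)
  ultimately have "bounded_clinear V"
    unfolding bounded_clinear_def by (auto intro!: bounded_linear_intro[where K=1] simp: nV)
  then have V: "isometric_embedding V" by (simp add: isometric_embedding_def nV)
  have Rsc: "R (d *\<^sub>C x) = d *\<^sub>C R x" and R0: "R 0 = 0" for d x
    using R by (auto simp: bounded_clinear_def linear_simps)
  have "fibre_map (inv \<sigma>) R (V x) = V (weighted_shift \<phi> \<omega> x)" for x
  proof (rule ell2_slice_eqI)
    fix p
    have lhs: "slice p (fibre_map (inv \<sigma>) R (V x)) = R (F x (inv \<sigma> p))"
      by (simp add: slice_fibre_map[OF bij_imp_bij_inv[OF \<sigma>] R] sl)
    show "slice p (fibre_map (inv \<sigma>) R (V x)) = slice p (V (weighted_shift \<phi> \<omega> x))"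
    proof (cases "inv \<sigma> p \<in> range \<iota>")
      case True
      then obtain i where i: "inv \<sigma> p = \<iota> i" by blast
      then have p: "p = \<iota> (\<phi> i)" using \<sigma> \<sigma>\<iota> by (metis bij_is_surj surj_f_inv_f)
      show ?thesis unfolding lhs sl
        unfolding i unfolding p F\<iota> Rsc Ru ell2_nth_weighted_shift[OF \<phi> \<omega>]
        by (simp add: \<phi> scaleC_scaleC mult.commute flip: scaleC_of_real)
    next
      case False
      \<comment> \<open>Nothing arrives in fibre p: if p belongs to an index k, then k is outside
        the range of \<phi>, where the shift has coordinate 0.\<close>
      have "F (weighted_shift \<phi> \<omega> x) p = 0"
      proof (cases "p \<in> range \<iota>")
        case True
        then obtain k where k: "p = \<iota> k" by blast
        have "k \<notin> range \<phi>" 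
        proof
          assume "k \<in> range \<phi>"
          then obtain i where "k = \<phi> i" by blast
          then have "inv \<sigma> p = \<iota> i" using k \<sigma>\<iota>[of i] bij_is_inj[OF \<sigma>] by (metis inv_f_f)
          then show False using False by simp
        qed
        then show ?thesis
          by (simp add: k F\<iota> ell2_nth_weighted_shift[OF \<phi> \<omega>])
      qed (simp add: F0)
      then show ?thesis using False unfolding lhs sl by (simp add: F0 R0)
    qed
  qed
  then show ?thesis
    unfolding subnormal_def
    using bounded_clinear_weighted_shift[of \<phi> \<omega> c, OF \<phi> \<omega>] V normal_operator_fibre_map[OF \<sigma> R RR] by blast
qed

section \<open>Change of the index set of the extension space\<close>

definition relabel :: "('i \<Rightarrow> 'j) \<Rightarrow> 'j ell2 \<Rightarrow> 'i ell2" where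
  "relabel h x = Abs_ell2 (\<lambda>i. ell2_nth x (h i))"

lemma ell2_nth_relabel:
  assumes "bij h"
  shows "ell2_nth (relabel h x) i = ell2_nth x (h i)"
  using summable_on_reindex_bij_betw[OF assms, of "\<lambda>j. (cmod (ell2_nth x j))\<^sup>2"] ell2_nth_summable[of x]
  by (simp add: relabel_def Abs_ell2_inverse)

lemma cinner_relabel:
  assumes "bij h"
  shows "cinner (relabel h x) (relabel h y) = cinner x y"
proof -
  have "((\<lambda>i. ell2_nth x (h i) * cnj (ell2_nth y (h i))) has_sum cinner x y) UNIV"
    by (rule has_sum_reindex_bij_betw[OF assms, THEN iffD2, OF has_sum_cinner_ell2])
  then show ?thesis
    using has_sum_unique has_sum_cinner_ell2[of "relabel h x" "relabel h y"]
    by (simp add: ell2_nth_relabel[OF assms]) blast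
qed

lemma isometric_embedding_relabel:
  assumes "bij h"
  shows "isometric_embedding (relabel h)"
proof -
  have n: "norm (relabel h x) = norm x" for x
    by (metis cinner_relabel[OF assms] cinner_self_norm of_real_eq_iff power2_eq_iff_nonneg norm_ge_zero)
  then show ?thesis
    unfolding isometric_embedding_def bounded_clinear_def
    by (auto intro!: bounded_linear_intro[where K=1] ell2_eqI
        simp: ell2_nth_relabel[OF assms] plus_ell2.rep_eq scaleC_ell2.rep_eq scaleR_ell2.rep_eq)
qed

text \<open>The theorem fixes \<open>nat ell2\<close> as extension space, while the extension is
  built over another index set. A bijection of index sets gives a unitary that carries the normal
  extension over.\<close>

lemma subnormal_relabel:
  fixes T :: "'h::chilbert_space \<Rightarrow> 'h"
  assumes h: "bij (h :: 'i \<Rightarrow> 'j)" and T: "subnormal TYPE('j ell2) T"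
  shows "subnormal TYPE('i ell2) T"
proof -
  obtain V :: "'h \<Rightarrow> 'j ell2" and N where V: "isometric_embedding V" and N: "normal_operator N"
    and NV: "\<And>x. N (V x) = V (T x)" and bT: "bounded_clinear T"
    using T unfolding subnormal_def by blast
  let ?U = "relabel h" and ?W = "relabel (inv h)"
  have UW: "?U (?W x) = x" for x
    using h by (intro ell2_eqI) (simp add: ell2_nth_relabel bij_imp_bij_inv bij_is_inj)
  have WU: "?W (?U x) = x" for x
    using h by (intro ell2_eqI) (simp add: ell2_nth_relabel bij_imp_bij_inv bij_is_surj surj_f_inv_f)
  have U: "isometric_embedding ?U" and W: "isometric_embedding ?W"
    using h by (simp_all add: isometric_embedding_relabel bij_imp_bij_inv)
  have sw: "cinner (?U x) y = cinner x (?W y)" for x y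
    by (metis UW cinner_relabel[OF h])
  have bN: "bounded_clinear N" and com: "N \<circ> adj N = adj N \<circ> N"
    using N by (auto simp: normal_operator_def)
  have "is_adjoint (?U \<circ> N \<circ> ?W) (?U \<circ> adj N \<circ> ?W)"
    using is_adjoint_adj[OF bN] unfolding is_adjoint_def o_def
    by (metis WU sw cinner_relabel[OF h] UW)
  then have adj: "adj (?U \<circ> N \<circ> ?W) = ?U \<circ> adj N \<circ> ?W" by (rule adj_eqI)
  have "normal_operator (?U \<circ> N \<circ> ?W)"
    unfolding normal_operator_def adj using com U W bN
    by (auto simp: isometric_embedding_def WU fun_eq_iff intro!: bounded_clinear_comp)
  moreover have "isometric_embedding (?U \<circ> V)"
    using U V by (auto simp: isometric_embedding_def intro!: bounded_clinear_comp)
  moreover have "(?U \<circ> N \<circ> ?W) ((?U \<circ> V) x) = (?U \<circ> V) (T x)" for x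
    by (simp add: WU NV)
  ultimately show ?thesis unfolding subnormal_def using bT by blast
qed

section \<open>Jacobi matrices\<close>

text \<open>Monic orthogonal polynomials by the three-term recurrence: \<open>pCons 0\<close>
  multiplies by the variable, and the quotients are the coefficients dictated by orthogonality to
  the two preceding polynomials. Orthogonality to all earlier ones is
  \<open>q_orthogonal\<close>.\<close>

fun orth_poly :: "(real poly \<Rightarrow> real) \<Rightarrow> nat \<Rightarrow> real poly" where
  "orth_poly L 0 = 1"
| "orth_poly L (Suc 0) = pCons 0 1 - smult (L (pCons 0 1) / L 1) 1"
| "orth_poly L (Suc (Suc n)) = (let q = orth_poly L (Suc n); q' = orth_poly L n in
     pCons 0 q - smult (L (pCons 0 q * q) / L (q * q)) q - smult (L (q * q) / L (q' * q')) q')"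

lemma coeff_orth_poly: "coeff (orth_poly L n) n = 1 \<and> (\<forall>i>n. coeff (orth_poly L n) i = 0)"
proof (induction L n rule: orth_poly.induct)
  case (1 L)
  then show ?case by (auto simp: coeff_eq_0)
next
  case (2 L)
  then show ?case by (auto simp: coeff_pCons coeff_1 split: nat.splits)
next
  case (3 L n)
  then show ?case by (auto simp: Let_def coeff_pCons split: nat.splits)
qed

text \<open>\<open>L\<close> models integration against a probability measure with infinite support
  in [-C, C]: \<open>L_pos\<close> makes \<open>L (p * q)\<close> an inner product, in which by
  \<open>L_bound\<close> multiplication by the variable has norm at most \<open>C\<close>.\<close>

locale moment_functional =
  fixes L :: "real poly \<Rightarrow> real" and C :: real
  assumes L_add: "L (p + q) = L p + L q"
    and L_smult: "L (smult c p) = c * L p"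
    and L_pos: "p \<noteq> 0 \<Longrightarrow> 0 < L (p * p)"
    and L_bound: "L (pCons 0 p * pCons 0 p) \<le> C\<^sup>2 * L (p * p)"
    and C_nonneg: "0 \<le> C"
    and L_one: "L 1 = 1"
begin

lemma L_diff: "L (p - q) = L p - L q"
  using L_add[of "p - q" q] by simp

lemma L_zero [simp]: "L 0 = 0"
  using L_add[of 0 0] by simp

lemma L_sq_nonneg: "0 \<le> L (p * p)"
  using L_pos[of p] by (cases "p = 0") auto

lemma L_Cauchy_Schwarz: "(L (p * q))\<^sup>2 \<le> L (p * p) * L (q * q)"
proof (cases "q = 0")
  case False
  define c where "c = L (p * q) / L (q * q)"
  have q: "0 < L (q * q)" using L_pos False by simp
  have "(p - smult c q) * (p - smult c q) = p * p - smult (2 * c) (p * q) + smult (c\<^sup>2) (q * q)"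
    by (simp add: algebra_simps power2_eq_square smult_add_left[symmetric] del: smult_add_left)
  then have "0 \<le> L (p * p) - 2 * c * L (p * q) + c\<^sup>2 * L (q * q)"
    using L_sq_nonneg[of "p - smult c q"] by (simp add: L_add L_diff L_smult)
  also have "\<dots> = L (p * p) - (L (p * q))\<^sup>2 / L (q * q)"
    using q by (simp add: c_def field_simps power2_eq_square)
  finally show ?thesis using q by (simp add: field_simps)
qed simp

abbreviation q where "q \<equiv> orth_poly L"

definition \<kappa> where "\<kappa> n = L (q n * q n)"
definition jac_diag where "jac_diag n = L (pCons 0 (q n) * q n) / \<kappa> n"
text \<open>The entry between degrees n - 1 and n. After the index shift in \<open>jacobi\<close> it
  joins basis vectors n and n + 1, so the value 0 at n = 0 decouples the spare vector.\<close>

definition jac_off where "jac_off n = (if n = 0 then 0 else sqrt (\<kappa> n / \<kappa> (n - 1)))"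

lemma \<kappa>_pos: "0 < \<kappa> n"
proof -
  have "q n \<noteq> 0" using coeff_orth_poly[of L n] by auto
  then show ?thesis by (simp add: \<kappa>_def L_pos)
qed

lemma q_recurrence:
  "pCons 0 (q n) = q (Suc n) + smult (jac_diag n) (q n)
     + (if n = 0 then 0 else smult (\<kappa> n / \<kappa> (n - 1)) (q (n - 1)))"
proof (cases n)
  case 0
  then show ?thesis by (simp add: jac_diag_def \<kappa>_def)
next
  case (Suc m)
  then show ?thesis by (simp add: jac_diag_def \<kappa>_def Let_def)
qed

lemma L_pCons_q:
  "L (r * pCons 0 (q n)) = L (r * q (Suc n)) + jac_diag n * L (r * q n)
     + (if n = 0 then 0 else \<kappa> n / \<kappa> (n - 1) * L (r * q (n - 1)))"
  by (subst q_recurrence) (simp add: distrib_left L_add L_smult del: mult_pCons_right)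

lemma q_orthogonal: "m < n \<Longrightarrow> L (q n * q m) = 0"
proof (induction n arbitrary: m rule: less_induct)
  case (less n)
  obtain k where n: "n = Suc k" using less.prems by (cases n) auto
  have IH: "L (q i * q j) = 0" if "j < i" "i \<le> k" for i j
    using less.IH[of i j] that n by simp
  have IH': "L (q j * q i) = 0" if "j < i" "i \<le> k" for i j
    using IH[OF that] by (simp add: mult.commute)
  have exp: "L (q n * q m) = L (q m * pCons 0 (q k)) - jac_diag k * L (q m * q k)
      - (if k = 0 then 0 else \<kappa> k / \<kappa> (k - 1) * L (q m * q (k - 1)))"
    unfolding L_pCons_q n by (simp add: mult.commute)
  show ?case
  proof (cases "m = k")
    case True
    have "jac_diag k * L (q k * q k) = L (q k * pCons 0 (q k))"
      using \<kappa>_pos[of k] by (simp add: jac_diag_def \<kappa>_def mult.commute)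
    moreover have "k \<noteq> 0 \<Longrightarrow> L (q k * q (k - 1)) = 0" by (rule IH) auto
    ultimately show ?thesis unfolding exp[unfolded True] True by simp
  next
    case False
    then have m: "m < k" using less.prems n by simp
    \<comment> \<open>Multiplication by the variable is symmetric for \<open>L\<close>, so it moves
      to the factor of lower degree, where only \<open>q (Suc m)\<close> can still meet
      \<open>q k\<close>.\<close>
    have "L (q m * pCons 0 (q k)) = L (q k * pCons 0 (q m))" by (simp add: mult.commute)
    also have "\<dots> = L (q k * q (Suc m))"
      unfolding L_pCons_q using IH[of m k] IH[of "m - 1" k] m by auto
    finally have e: "L (q m * pCons 0 (q k)) = L (q k * q (Suc m))" .
    have z: "L (q m * q k) = 0" using IH'[OF m] by simp
    show ?thesis
    proof (cases "Suc m = k")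
      case True
      then have k1: "k - 1 = m" "k \<noteq> 0" by auto
      have "\<kappa> k / \<kappa> m * L (q m * q m) = L (q k * q k)"
        using \<kappa>_pos[of m] by (simp add: \<kappa>_def)
      then show ?thesis unfolding exp e z k1(1) True using k1 by simp
    next
      case False
      then have "Suc m < k" using m by simp
      then have "L (q k * q (Suc m)) = 0" "L (q m * q (k - 1)) = 0"
        using IH[of "Suc m" k] IH'[of m "k - 1"] by auto
      then show ?thesis unfolding exp e z by simp
    qed
  qed
qed

text \<open>This and \<open>jac_off_bound\<close> hold because the entries are matrix coefficients
  of multiplication by the variable in the normalised polynomials; Cauchy-Schwarz and
  \<open>L_bound\<close> do the rest.\<close>

lemma jac_diag_bound: "\<bar>jac_diag n\<bar> \<le> C"
proof -
  have "(L (pCons 0 (q n) * q n))\<^sup>2 \<le> L (pCons 0 (q n) * pCons 0 (q n)) * \<kappa> n"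
    unfolding \<kappa>_def by (rule L_Cauchy_Schwarz)
  also have "\<dots> \<le> C\<^sup>2 * \<kappa> n * \<kappa> n"
    using L_bound[of "q n"] \<kappa>_pos[of n] unfolding \<kappa>_def[symmetric] by (intro mult_right_mono) auto
  also have "\<dots> = (C * \<kappa> n)\<^sup>2" by (simp add: power2_eq_square)
  finally have "(L (pCons 0 (q n) * q n))\<^sup>2 \<le> (C * \<kappa> n)\<^sup>2" .
  then have "\<bar>L (pCons 0 (q n) * q n)\<bar> \<le> C * \<kappa> n"
    using C_nonneg \<kappa>_pos[of n] by (metis abs_le_square_iff abs_of_nonneg less_imp_le mult_nonneg_nonneg)
  then show ?thesis
    using \<kappa>_pos[of n] by (simp add: jac_diag_def abs_divide divide_le_eq del: mult_pCons_left)
qed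

lemma jac_off_bound: "\<bar>jac_off n\<bar> \<le> C"
proof (cases n)
  case 0
  then show ?thesis using C_nonneg by (simp add: jac_off_def)
next
  case (Suc m)
  have "L (q (Suc m) * pCons 0 (q m)) = \<kappa> (Suc m)"
    unfolding L_pCons_q using q_orthogonal[of m "Suc m"] q_orthogonal[of "m - 1" "Suc m"]
    by (auto simp: \<kappa>_def)
  then have "(\<kappa> (Suc m))\<^sup>2 \<le> \<kappa> (Suc m) * L (pCons 0 (q m) * pCons 0 (q m))"
    using L_Cauchy_Schwarz[of "q (Suc m)" "pCons 0 (q m)"]
    unfolding \<kappa>_def[symmetric] by (simp del: mult_pCons_left mult_pCons_right)
  also have "\<dots> \<le> \<kappa> (Suc m) * (C\<^sup>2 * \<kappa> m)"
    unfolding \<kappa>_def[of m] using \<kappa>_pos[of "Suc m"] by (intro mult_left_mono L_bound) simp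
  finally have "\<kappa> (Suc m) \<le> C\<^sup>2 * \<kappa> m"
    using \<kappa>_pos[of "Suc m"] by (simp add: power2_eq_square)
  then have "\<kappa> (Suc m) / \<kappa> m \<le> C\<^sup>2" using \<kappa>_pos[of m] by (simp add: divide_le_eq)
  then have "sqrt (\<kappa> (Suc m) / \<kappa> m) \<le> C" using C_nonneg by (intro real_le_lsqrt) auto
  moreover have "0 \<le> sqrt (\<kappa> (Suc m) / \<kappa> m)" using \<kappa>_pos[of m] \<kappa>_pos[of "Suc m"] by simp
  ultimately show ?thesis using Suc by (simp add: jac_off_def)
qed

text \<open>Index 0 carries a spare basis vector, annihilated by the operator; the basis vector with index
  \<open>Suc n\<close> represents the normalised orthogonal polynomial of degree \<open>n\<close>.\<close>

definition jacobi :: "nat ell2 \<Rightarrow> nat ell2" where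
  "jacobi = (\<lambda>x. weighted_shift Suc jac_off x + adj (weighted_shift Suc jac_off) x
     + weighted_shift id (\<lambda>n. if n = 0 then 0 else jac_diag (n - 1)) x)"

lemma diag_bound: "\<bar>if n = 0 then 0 else jac_diag (n - 1)\<bar> \<le> C"
  using jac_diag_bound C_nonneg by simp

lemma bounded_clinear_jacobi: "bounded_clinear jacobi"
  unfolding jacobi_def
  by (intro bounded_clinear_plus bounded_clinear_adj
      bounded_clinear_weighted_shift[of Suc, OF inj_Suc jac_off_bound]
      bounded_clinear_weighted_shift[of id, OF inj_on_id diag_bound])

lemma is_adjoint_jacobi: "is_adjoint jacobi jacobi"
proof -
  let ?B = "weighted_shift Suc jac_off" and ?D = "weighted_shift id (\<lambda>n. if n = 0 then 0 else jac_diag (n - 1))"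
  have B: "is_adjoint ?B (adj ?B)"
    by (intro is_adjoint_adj bounded_clinear_weighted_shift[of Suc, OF inj_Suc jac_off_bound])
  have bD: "bounded_clinear ?D" by (rule bounded_clinear_weighted_shift[of id, OF inj_on_id diag_bound])
  have "adj ?D x = ?D x" for x
    by (rule ell2_eqI) (simp add: ell2_nth_adj_weighted_shift[of id, OF _ diag_bound]
        ell2_nth_weighted_shift[of id, OF _ diag_bound])
  then have D: "is_adjoint ?D ?D" using is_adjoint_adj[OF bD] by (simp add: is_adjoint_def)
  show ?thesis
    using B D is_adjoint_sym[OF B]
    by (simp add: is_adjoint_def jacobi_def cinner_add_left cinner_add_right)
qed

lemma ell2_nth_jacobi:
  "ell2_nth (jacobi x) 0 = 0"
  "ell2_nth (jacobi x) (Suc n) = jac_off n * ell2_nth x n + jac_diag n * ell2_nth x (Suc n)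
     + jac_off (Suc n) * ell2_nth x (Suc (Suc n))"
  by (simp_all add: jacobi_def plus_ell2.rep_eq ell2_nth_weighted_shift[OF inj_Suc jac_off_bound]
      ell2_nth_adj_weighted_shift[OF inj_Suc jac_off_bound]
      ell2_nth_weighted_shift[of id, OF _ diag_bound] jac_off_def)

lemma jacobi_ket_0: "jacobi (ket 0) = 0"
  by (rule ell2_eqI, rename_tac i, case_tac i)
    (auto simp: ell2_nth_jacobi ell2_nth_ket zero_ell2.rep_eq jac_off_def)

text \<open>The coordinates are the Fourier coefficients of the monomial of degree l in the
  normalised polynomials; by the recurrence, \<open>jacobi\<close> acts on them as multiplication by
  the variable.\<close>

lemma ell2_nth_jacobi_power:
  "ell2_nth ((jacobi ^^ l) (ket 1)) 0 = 0"
  "ell2_nth ((jacobi ^^ l) (ket 1)) (Suc n) = L (monom 1 l * q n) / sqrt (\<kappa> n)"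
proof -
  have "ell2_nth ((jacobi ^^ l) (ket 1)) 0 = 0 \<and>
    (\<forall>n. ell2_nth ((jacobi ^^ l) (ket 1)) (Suc n) = L (monom 1 l * q n) / sqrt (\<kappa> n))"
  proof (induction l)
    case 0
    have "L (q n) = (if n = 0 then 1 else 0)" for n
      using q_orthogonal[of 0 n] L_one by auto
    moreover have "\<kappa> 0 = 1" by (simp add: \<kappa>_def L_one)
    ultimately show ?case by (auto simp: ell2_nth_ket)
  next
    case (Suc l)
    let ?y = "(jacobi ^^ l) (ket 1)"
    have "ell2_nth (jacobi ?y) (Suc n) = L (monom 1 (Suc l) * q n) / sqrt (\<kappa> n)" for n
    proof -
      have k: "0 < sqrt (\<kappa> n)" for n using \<kappa>_pos by simp
      have sq: "\<kappa> n = sqrt (\<kappa> n) * sqrt (\<kappa> n)" for n using \<kappa>_pos[of n] by simp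
      have "monom 1 (Suc l) * q n = monom 1 l * pCons 0 (q n)" by (simp add: monom_Suc)
      then have "L (monom 1 (Suc l) * q n) / sqrt (\<kappa> n) =
        (L (monom 1 l * q (Suc n)) + jac_diag n * L (monom 1 l * q n)
        + (if n = 0 then 0 else \<kappa> n / \<kappa> (n - 1) * L (monom 1 l * q (n - 1)))) / sqrt (\<kappa> n)"
        by (simp only: L_pCons_q)
      also have "\<dots> = jac_off n * (if n = 0 then 0 else L (monom 1 l * q (n - 1)) / sqrt (\<kappa> (n - 1)))
        + jac_diag n * (L (monom 1 l * q n) / sqrt (\<kappa> n))
        + jac_off (Suc n) * (L (monom 1 l * q (Suc n)) / sqrt (\<kappa> (Suc n)))"
        unfolding jac_off_def real_sqrt_divide
        using k[of n] k[of "n - 1"] k[of "Suc n"] sq[of n] sq[of "n - 1"]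
        by (simp add: add_divide_distrib) (simp add: field_simps)
      finally have e: "L (monom 1 (Suc l) * q n) / sqrt (\<kappa> n) = \<dots>" .
      \<comment> \<open>Index n belongs to degree n - 1; index 0 is the spare coordinate, zero by
        induction.\<close>
      have y: "ell2_nth ?y n = complex_of_real (if n = 0 then 0 else L (monom 1 l * q (n - 1)) / sqrt (\<kappa> (n - 1)))"
        using Suc by (cases n) auto
      show ?thesis unfolding e ell2_nth_jacobi(2) y using Suc by simp
    qed
    then show ?case by (simp add: ell2_nth_jacobi(1))
  qed
  then show "ell2_nth ((jacobi ^^ l) (ket 1)) 0 = 0"
    "ell2_nth ((jacobi ^^ l) (ket 1)) (Suc n) = L (monom 1 l * q n) / sqrt (\<kappa> n)" by auto
qed

text \<open>Self-adjointness turns the squared norm into the degree 0 coordinate of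
  \<open>(jacobi ^^ (2 * l)) (ket 1)\<close>, and \<open>q 0\<close> is 1.\<close>

lemma norm_jacobi_power: "(norm ((jacobi ^^ l) (ket 1)))\<^sup>2 = L (monom 1 (2 * l))"
proof -
  have "cinner ((jacobi ^^ l) (ket 1)) ((jacobi ^^ l) (ket 1)) = cinner ((jacobi ^^ l) ((jacobi ^^ l) (ket 1))) (ket 1)"
    using is_adjoint_funpow[OF is_adjoint_jacobi, of l] by (simp add: is_adjoint_def)
  also have "(jacobi ^^ l) ((jacobi ^^ l) (ket 1)) = (jacobi ^^ (2 * l)) (ket 1)"
    by (simp add: funpow_add mult_2)
  also have "cinner \<dots> (ket 1) = L (monom 1 (2 * l))"
    using ell2_nth_jacobi_power(2)[of "2 * l" 0] by (simp add: cinner_ket \<kappa>_def L_one)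
  finally have "complex_of_real ((norm ((jacobi ^^ l) (ket 1)))\<^sup>2) = complex_of_real (L (monom 1 (2 * l)))"
    by (simp only: cinner_self_norm)
  then show ?thesis by (simp only: of_real_eq_iff)
qed

end

section \<open>Moments of Lebesgue measure\<close>

text \<open>The exponent is l - 1: \<open>mom 0\<close> is the integral of dt/t, and the moments of
  dt itself start at \<open>mom 1\<close>.\<close>

definition mom :: "nat \<Rightarrow> real" where
  "mom l = integral {1/2..3/2} (\<lambda>t. t ^ l / t)"

lemma mom_0: "mom 0 = ln 3"
proof -
  have "((\<lambda>t::real. 1 / t) has_integral (ln (3/2) - ln (1/2))) {1/2..3/2}"
    by (rule fundamental_theorem_of_calculus)
      (auto intro!: derivative_eq_intros simp flip: has_real_derivative_iff_has_vector_derivative)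
  moreover have "ln (3/2) - ln (1/2) = ln (3::real)" using ln_div[of "3/2" "1/2::real"] by simp
  ultimately show ?thesis by (simp add: mom_def integral_unique)
qed

lemma mom_Suc: "mom (Suc l) = ((3/2) ^ Suc l - (1/2) ^ Suc l) / real (Suc l)"
proof -
  have "((\<lambda>t::real. t ^ l) has_integral ((3/2) ^ Suc l / real (Suc l) - (1/2) ^ Suc l / real (Suc l))) {1/2..3/2}"
    by (rule fundamental_theorem_of_calculus)
      (auto intro!: derivative_eq_intros simp flip: has_real_derivative_iff_has_vector_derivative
        simp del: of_nat_Suc power_Suc)
  then have "((\<lambda>t::real. t ^ Suc l / t) has_integral (((3/2) ^ Suc l - (1/2) ^ Suc l) / real (Suc l))) {1/2..3/2}"
    unfolding diff_divide_distrib by (rule has_integral_eq[rotated]) auto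
  then show ?thesis unfolding mom_def by (rule integral_unique)
qed

lemma mom_1: "mom 1 = 1"
  using mom_Suc[of 0] by simp

lemma mom_pos: "0 < mom l"
proof (cases l)
  case (Suc k)
  have "(1/2) ^ Suc k < (3/2::real) ^ Suc k" by (rule power_strict_mono) auto
  then show ?thesis unfolding Suc mom_Suc by simp
qed (simp add: mom_0)

text \<open>The probability measure dt/(t ln 3) in the variable r = sqrt t. Its moment of order 2l
  is \<open>mom l / ln 3\<close>, which makes this the squared norm of the l-th orbit vector under
  multiplication by r.\<close>

definition mom_functional :: "real poly \<Rightarrow> real" where
  "mom_functional p = integral {sqrt (1/2)..sqrt (3/2)} (\<lambda>r. poly p r * (2 / r)) / ln 3"

lemma sqrt_interval_pos: "r \<in> {sqrt (1/2)..sqrt (3/2)} \<Longrightarrow> 0 < r"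
  by (auto intro: less_le_trans[rotated])

lemma mom_functional_even: "mom_functional (monom 1 (2 * l)) = mom l / ln 3"
proof (cases l)
  case 0
  have "((\<lambda>r::real. 2 / r) has_integral (2 * ln (sqrt (3/2)) - 2 * ln (sqrt (1/2)))) {sqrt (1/2)..sqrt (3/2)}"
    by (rule fundamental_theorem_of_calculus)
      (auto intro!: derivative_eq_intros dest!: sqrt_interval_pos[OF atLeastAtMost_iff[THEN iffD2], OF conjI]
         simp flip: has_real_derivative_iff_has_vector_derivative)
  moreover have "2 * ln (sqrt (3/2)) - 2 * ln (sqrt (1/2)) = ln (3::real)"
    using ln_div[of "3/2" "1/2::real"] by (simp add: ln_sqrt)
  ultimately show ?thesis using 0 by (simp add: mom_functional_def mom_0 integral_unique)
next
  case (Suc k)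
  have d: "((\<lambda>r. r ^ (2 * l) / real l) has_real_derivative 2 * r ^ (2 * k + 1)) (at r within A)" for r A
    by (rule DERIV_cong[OF DERIV_cdivide[OF DERIV_pow]]) (simp add: Suc divide_eq_eq algebra_simps)
  have "((\<lambda>r::real. 2 * r ^ (2 * k + 1)) has_integral
      (sqrt (3/2) ^ (2 * l) / real l - sqrt (1/2) ^ (2 * l) / real l)) {sqrt (1/2)..sqrt (3/2)}"
    by (rule fundamental_theorem_of_calculus)
      (use d in \<open>auto simp flip: has_real_derivative_iff_has_vector_derivative\<close>)
  then have int: "((\<lambda>r::real. poly (monom 1 (2 * l)) r * (2 / r)) has_integral
      (sqrt (3/2) ^ (2 * l) / real l - sqrt (1/2) ^ (2 * l) / real l)) {sqrt (1/2)..sqrt (3/2)}"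
    by (rule has_integral_eq[rotated]) (auto simp: poly_monom Suc dest!: sqrt_interval_pos[OF atLeastAtMost_iff[THEN iffD2], OF conjI])
  have sq: "sqrt c ^ (2 * l) = c ^ l" if "0 \<le> c" for c
    using that by (simp add: power_mult)
  have "sqrt (3/2) ^ (2 * l) / real l - sqrt (1/2) ^ (2 * l) / real l = mom l"
    unfolding sq[of "3/2", simplified] sq[of "1/2", simplified] by (simp only: Suc mom_Suc diff_divide_distrib)
  then show ?thesis unfolding mom_functional_def integral_unique[OF int] by simp
qed

lemma mom_functional_integrand_continuous:
  "continuous_on {sqrt (1/2)..sqrt (3/2)} (\<lambda>r. poly p r * (2 / r))"
  using sqrt_interval_pos by (intro continuous_intros) force

text \<open>Strict positivity: a continuous nonnegative integrand with integral zero vanishes on the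
  whole interval, while a nonzero polynomial has finitely many roots. The norm bound is r^2 \<le>
  3/2.\<close>

lemma moment_functional_mom: "moment_functional mom_functional (sqrt (3/2))"
proof
  let ?I = "{sqrt (1/2)..sqrt (3/2::real)}"
  note int = integrable_continuous_interval[OF mom_functional_integrand_continuous]
  fix p q :: "real poly" and c :: real
  show "mom_functional (p + q) = mom_functional p + mom_functional q"
    unfolding mom_functional_def poly_add distrib_right integral_add[OF int int] by (simp add: add_divide_distrib)
  show "mom_functional (smult c p) = c * mom_functional p"
    unfolding mom_functional_def poly_smult mult.assoc integral_mult_right by simp
  show "0 < mom_functional (p * p)" if "p \<noteq> 0"
  proof -
    have nn: "0 \<le> poly (p * p) r * (2 / r)" if "r \<in> ?I" for r
      using sqrt_interval_pos[OF that] by simp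
    have "integral ?I (\<lambda>r. poly (p * p) r * (2 / r)) \<noteq> 0"
    proof
      assume "integral ?I (\<lambda>r. poly (p * p) r * (2 / r)) = 0"
      then have "\<forall>r\<in>?I. poly (p * p) r * (2 / r) = 0"
        using nn by (subst (asm) integral_eq_0_iff[OF mom_functional_integrand_continuous]) auto
      then have "?I \<subseteq> {r. poly p r = 0}"
        using sqrt_interval_pos by fastforce
      moreover have "infinite ?I" by simp
      ultimately show False using poly_roots_finite[OF that] finite_subset by blast
    qed
    moreover have "0 \<le> integral ?I (\<lambda>r. poly (p * p) r * (2 / r))"
      by (rule integral_nonneg[OF int nn])
    ultimately show ?thesis by (simp add: mom_functional_def)
  qed
  show "mom_functional (pCons 0 p * pCons 0 p) \<le> (sqrt (3/2))\<^sup>2 * mom_functional (p * p)"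
  proof -
    have "integral ?I (\<lambda>r. poly (pCons 0 p * pCons 0 p) r * (2 / r))
      \<le> integral ?I (\<lambda>r. 3/2 * (poly (p * p) r * (2 / r)))"
    proof (rule integral_le[OF int])
      show "(\<lambda>r. 3/2 * (poly (p * p) r * (2 / r))) integrable_on ?I"
        using int[of "smult (3/2) (p * p)"] by (simp add: mult.assoc)
      fix r assume r: "r \<in> ?I"
      note r0 = sqrt_interval_pos[OF r]
      have "r\<^sup>2 \<le> 3/2" using r r0 by (metis atLeastAtMost_iff real_sqrt_le_iff real_sqrt_abs abs_of_pos)
      then have "r\<^sup>2 * (poly p r * poly p r * (2 / r)) \<le> 3/2 * (poly p r * poly p r * (2 / r))"
        using r0 by (intro mult_right_mono) auto
      then show "poly (pCons 0 p * pCons 0 p) r * (2 / r) \<le> 3/2 * (poly (p * p) r * (2 / r))"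
        using r0 unfolding poly_mult poly_pCons by (simp add: power2_eq_square mult_ac)
    qed
    then have "integral ?I (\<lambda>r. poly (pCons 0 p * pCons 0 p) r * (2 / r)) / ln 3
      \<le> 3/2 * integral ?I (\<lambda>r. poly (p * p) r * (2 / r)) / ln 3"
      unfolding integral_mult_right by (rule divide_right_mono) simp
    moreover have "(sqrt (3/2))\<^sup>2 = (3/2 :: real)" by simp
    ultimately show ?thesis unfolding mom_functional_def by (simp only: times_divide_eq_right)
  qed
  show "mom_functional 1 = 1" using mom_functional_even[of 0] by (simp add: mom_0)
qed simp

text \<open>The properties of \<open>jacobi\<close> used from here on. In particular
  \<open>ket 0\<close> is a unit vector in the kernel, orthogonal to the orbit of
  \<open>ket 1\<close>.\<close>

lemma mom_operator_exists:
  obtains J :: "nat ell2 \<Rightarrow> nat ell2" where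
    "bounded_clinear J" "is_adjoint J J" "\<And>x. ell2_nth (J x) 0 = 0" "J (ket 0) = 0"
    "\<And>l. norm ((J ^^ l) (ket 1)) = sqrt (mom l / ln 3)"
proof -
  interpret moment_functional mom_functional "sqrt (3/2)" by (rule moment_functional_mom)
  have "norm ((jacobi ^^ l) (ket 1)) = sqrt (mom l / ln 3)" for l
    using norm_jacobi_power[of l] by (metis mom_functional_even norm_ge_zero real_sqrt_unique)
  then show ?thesis
    using that[OF bounded_clinear_jacobi is_adjoint_jacobi ell2_nth_jacobi(1) jacobi_ket_0] by blast
qed

section \<open>Subnormal shifts of the lattice\<close>

text \<open>Square roots of the moments of dt/(t ln 3); from l = 1 on, consecutive quotients are the
  weights \<beta>.\<close>

definition \<nu> :: "nat \<Rightarrow> real" where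
  "\<nu> l = sqrt (mom l / ln 3)"

lemma \<nu>_pos: "0 < \<nu> l"
  by (simp add: \<nu>_def mom_pos)

lemma \<nu>_0: "\<nu> 0 = 1"
  by (simp add: \<nu>_def mom_0)

lemma \<nu>_power2: "(\<nu> l)\<^sup>2 = mom l / ln 3"
  using mom_pos[of l] by (simp add: \<nu>_def)

text \<open>\<nu> (l + n) is the norm of J^n applied to J^l e, so a bound for J^n bounds the
  quotients.\<close>

lemma \<nu>_ratio_bounded: "\<exists>K. \<forall>l. \<nu> (l + n) / \<nu> l \<le> K"
proof -
  obtain J :: "nat ell2 \<Rightarrow> nat ell2" where J: "bounded_clinear J"
    and nrm: "\<And>l. norm ((J ^^ l) (ket 1)) = sqrt (mom l / ln 3)"
    by (rule mom_operator_exists) blast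
  obtain K where K: "\<And>x. norm ((J ^^ n) x) \<le> norm x * K"
    using bounded_clinear_funpow[OF J, of n] bounded_linear.bounded unfolding bounded_clinear_def by blast
  have "\<nu> (l + n) \<le> \<nu> l * K" for l
    using K[of "(J ^^ l) (ket 1)"] nrm[of "n + l"] nrm[of l]
    unfolding \<nu>_def add.commute[of l n] by (simp only: funpow_add o_apply)
  then have "\<nu> (l + n) / \<nu> l \<le> K" for l using \<nu>_pos[of l] by (simp add: divide_le_eq mult.commute)
  then show ?thesis by blast
qed

text \<open>Cauchy-Schwarz for J^l e and J^(l+2) e, whose inner product is the squared norm of
  J^(l+1) e. It yields the monotonicity of the weights \<beta>.\<close>

lemma \<nu>_log_convex: "\<nu> (Suc l) / \<nu> l \<le> \<nu> (Suc (Suc l)) / \<nu> (Suc l)"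
proof -
  obtain J :: "nat ell2 \<Rightarrow> nat ell2" where JJ: "is_adjoint J J"
    and nrm: "\<And>l. norm ((J ^^ l) (ket 1)) = sqrt (mom l / ln 3)"
    by (rule mom_operator_exists) blast
  define e where "e l = (J ^^ l) (ket 1)" for l
  have n: "norm (e l) = \<nu> l" for l unfolding e_def \<nu>_def by (rule nrm)
  have "(norm (e (Suc l)))\<^sup>2 = inner (e l) (e (Suc (Suc l)))"
    using JJ by (simp add: power2_norm_eq_inner inner_eq_Re_cinner e_def is_adjoint_def)
  also have "\<dots> \<le> norm (e l) * norm (e (Suc (Suc l)))" by (rule norm_cauchy_schwarz)
  finally show ?thesis
    using \<nu>_pos[of l] \<nu>_pos[of "Suc l"] by (simp add: n divide_simps power2_eq_square mult.commute)
qed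

text \<open>For weights that are quotients of one function G, products telescope: T1^m T2^n is a
  single weighted shift along (m, n), and commutation is automatic.\<close>

definition lattice_shift :: "(nat \<times> nat \<Rightarrow> real) \<Rightarrow> nat \<Rightarrow> nat \<Rightarrow> (nat \<times> nat) ell2 \<Rightarrow> (nat \<times> nat) ell2" where
  "lattice_shift G m n = weighted_shift (\<lambda>(k1, k2). (k1 + m, k2 + n))
     (\<lambda>(k1, k2). G (k1 + m, k2 + n) / G (k1, k2))"

lemma inj_translation: "inj (\<lambda>(k1, k2). (k1 + m, k2 + n) :: nat \<times> nat)"
  by (auto simp: inj_def)

lemma lattice_shift_comp:
  assumes G: "\<And>k. 0 < G k" and bd: "\<And>m n. \<exists>c. \<forall>k1 k2. G (k1 + m, k2 + n) / G (k1, k2) \<le> c"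
  shows "lattice_shift G m n \<circ> lattice_shift G m' n' = lattice_shift G (m + m') (n + n')"
proof -
  have ex: "\<exists>c. \<forall>k. \<bar>(\<lambda>(k1, k2). G (k1 + m, k2 + n) / G (k1, k2)) k\<bar> \<le> c" for m n
    using bd[of m n] G by (auto simp: abs_divide abs_of_pos)
  obtain c where c: "\<And>k. \<bar>(\<lambda>(k1, k2). G (k1 + m, k2 + n) / G (k1, k2)) k\<bar> \<le> c" using ex by blast
  obtain d where d: "\<And>k. \<bar>(\<lambda>(k1, k2). G (k1 + m', k2 + n') / G (k1, k2)) k\<bar> \<le> d" using ex by blast
  have g: "G k \<noteq> 0" for k using G[of k] by simp
  show ?thesis
    unfolding lattice_shift_def weighted_shift_comp[OF inj_translation c inj_translation d]
    by (rule arg_cong2[where f=weighted_shift]) (auto simp: fun_eq_iff g add_ac)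
qed

lemma lattice_shift_0_0:
  assumes G: "\<And>k. 0 < G k"
  shows "lattice_shift G 0 0 = id"
proof -
  have g: "G k \<noteq> 0" for k using G[of k] by simp
  have "lattice_shift G 0 0 = weighted_shift id (\<lambda>_. 1)"
    unfolding lattice_shift_def by (rule arg_cong2[where f=weighted_shift]) (auto simp: fun_eq_iff g)
  also have "\<dots> = id"
    by (intro ext ell2_eqI) (simp add: ell2_nth_weighted_shift[of id "\<lambda>_. 1" 1])
  finally show ?thesis .
qed

lemma lattice_shift_funpow:
  assumes G: "\<And>k. 0 < G k" and bd: "\<And>m n. \<exists>c. \<forall>k1 k2. G (k1 + m, k2 + n) / G (k1, k2) \<le> c"
  shows "lattice_shift G m n ^^ j = lattice_shift G (j * m) (j * n)"
proof (induction j)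
  case 0
  then show ?case by (simp add: lattice_shift_0_0[OF G] id_def)
next
  case (Suc j)
  have "lattice_shift G m n ^^ Suc j = lattice_shift G m n \<circ> lattice_shift G (j * m) (j * n)"
    using Suc by simp
  also have "\<dots> = lattice_shift G (Suc j * m) (Suc j * n)"
    by (simp only: lattice_shift_comp[OF G bd] mult_Suc)
  finally show ?case .
qed

text \<open>The fibre vector at k is \<open>u k\<close>, a combination of the normalised orbit
  vector and \<open>ket 0\<close>, with coefficient \<open>\<rho> k\<close>, the drop of g in one
  step, on the former. \<open>R\<close> kills \<open>ket 0\<close> and advances the orbit by n.
  \<open>dec\<close> gives \<open>\<rho> k \<le> 1\<close>; \<open>stab\<close> makes \<rho> equal
  to 1 one step later, so \<open>R (u k)\<close> is a multiple of the next fibre vector.\<close>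

lemma subnormal_lattice_shift:
  assumes g: "\<And>k. 0 < g k" and dec: "\<And>k1 k2. g (k1 + m, k2 + n) \<le> g (k1, k2)"
    and stab: "\<And>k1 k2. g (k1 + m + m, k2 + n + n) = g (k1 + m, k2 + n)"
  shows "subnormal TYPE(nat ell2) (lattice_shift (\<lambda>(k1, k2). g (k1, k2) * \<nu> k2) m n)"
proof -
  obtain J :: "nat ell2 \<Rightarrow> nat ell2" where J: "bounded_clinear J" and JJ: "is_adjoint J J"
    and J_nth: "\<And>x. ell2_nth (J x) 0 = 0" and J0: "J (ket 0) = 0"
    and nrm: "\<And>l. norm ((J ^^ l) (ket 1)) = sqrt (mom l / ln 3)"
    by (rule mom_operator_exists) blast
  define e where "e l = (J ^^ l) (ket 1)" for l
  have ne: "norm (e l) = \<nu> l" for l unfolding e_def \<nu>_def by (rule nrm)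
  have e0: "ell2_nth (e l) 0 = 0" for l by (cases l) (auto simp: e_def J_nth ell2_nth_ket)
  define P :: "nat ell2 \<Rightarrow> nat ell2" where "P = weighted_shift id (\<lambda>i. if i = 0 then 0 else 1)"
  have b1: "\<bar>if i = 0 then 0 else 1\<bar> \<le> (1::real)" for i :: nat by simp
  have P_nth: "ell2_nth (P x) i = (if i = 0 then 0 else ell2_nth x i)" for x i
    unfolding P_def by (simp add: ell2_nth_weighted_shift[OF inj_on_id b1])
  have P: "bounded_clinear P" unfolding P_def by (rule bounded_clinear_weighted_shift[OF inj_on_id b1])
  have "adj P = P" unfolding P_def
    by (intro ext ell2_eqI)
      (simp add: ell2_nth_weighted_shift[OF inj_on_id b1] ell2_nth_adj_weighted_shift[OF inj_on_id b1])
  then have PP: "is_adjoint P P" using is_adjoint_adj[OF P] by simp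
  \<comment> \<open>For n = 0 the power J^0 would not kill \<open>ket 0\<close>; the projection off
    \<open>ket 0\<close> replaces it, and it fixes every \<open>e l\<close>.\<close>
  define R where "R = (if n = 0 then P else J ^^ n)"
  have R: "bounded_clinear R" by (simp add: R_def P bounded_clinear_funpow[OF J])
  have RR: "is_adjoint R R" by (simp add: R_def PP is_adjoint_funpow[OF JJ])
  have Rlin: "R (x + y) = R x + R y" "R (r *\<^sub>R x) = r *\<^sub>R R x" for x y r
    using R by (auto simp: bounded_clinear_def linear_simps)
  have Jz: "(J ^^ j) 0 = 0" for j
    using bounded_clinear_funpow[OF J, of j] by (auto simp: bounded_clinear_def linear_simps)
  have R0: "R (ket 0) = 0"
  proof (cases n)
    case 0
    then show ?thesis by (intro ell2_eqI) (simp add: R_def P_nth ell2_nth_ket zero_ell2.rep_eq)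
  next
    case (Suc j)
    then show ?thesis by (simp add: R_def funpow_Suc_right J0 Jz del: funpow.simps)
  qed
  have Re: "R (e l) = e (l + n)" for l
  proof (cases "n = 0")
    case True
    have "P (e l) = e l" by (rule ell2_eqI) (simp add: P_nth e0)
    then show ?thesis using True by (simp add: R_def)
  next
    case False
    then show ?thesis by (simp add: R_def e_def funpow_add add.commute[of l n])
  qed
  define \<rho> where "\<rho> k = g (fst k + m, snd k + n) / g k" for k
  have \<rho>: "0 < \<rho> k" "\<rho> k \<le> 1" for k
    using g dec[of "fst k" "snd k"] by (auto simp: \<rho>_def)
  define u where "u k = (\<rho> k / \<nu> (snd k)) *\<^sub>R e (snd k) + sqrt (1 - (\<rho> k)\<^sup>2) *\<^sub>R ket 0" for k
  have nu: "norm (u k) = 1" for k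
  proof -
    have orth: "inner (e l) (ket 0) = 0" for l by (simp add: inner_eq_Re_cinner cinner_ket e0)
    have sq: "(\<rho> k)\<^sup>2 \<le> 1" using \<rho>[of k] by (simp add: power_le_one)
    have "(norm (u k))\<^sup>2 = (\<rho> k / \<nu> (snd k))\<^sup>2 * (norm (e (snd k)))\<^sup>2 + (1 - (\<rho> k)\<^sup>2)"
      using sq orth unfolding u_def power2_norm_eq_inner
      by (simp add: inner_add_left inner_add_right inner_commute power2_eq_square
          norm_eq_1[THEN iffD1, OF norm_ket])
    also have "\<dots> = 1" using \<nu>_pos[of "snd k"] by (simp add: ne power_divide)
    finally show ?thesis by (metis norm_ge_zero power2_eq_iff_nonneg one_power2 zero_le_one)
  qed
  define \<omega> where "\<omega> = (\<lambda>(k1, k2). g (k1 + m, k2 + n) * \<nu> (k2 + n) / (g (k1, k2) * \<nu> k2))"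
  have \<omega>_eq: "\<omega> k = \<rho> k * (\<nu> (snd k + n) / \<nu> (snd k))" for k
    by (simp add: \<omega>_def \<rho>_def case_prod_unfold)
  have Ru: "R (u k) = \<omega> k *\<^sub>R u (fst k + m, snd k + n)" for k
  proof -
    have "\<rho> (fst k + m, snd k + n) = 1" using stab g[of "(fst k + m, snd k + n)"] by (simp add: \<rho>_def)
    then have "u (fst k + m, snd k + n) = (1 / \<nu> (snd k + n)) *\<^sub>R e (snd k + n)" by (simp add: u_def)
    moreover have "R (u k) = (\<rho> k / \<nu> (snd k)) *\<^sub>R e (snd k + n)"
      by (simp add: u_def Rlin Re R0)
    ultimately show ?thesis using \<nu>_pos[of "snd k + n"] by (simp add: \<omega>_eq)
  qed
  obtain K where K: "\<And>l. \<nu> (l + n) / \<nu> l \<le> K" using \<nu>_ratio_bounded[of n] by blast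
  have bd: "\<bar>\<omega> k\<bar> \<le> K" for k
  proof -
    have "0 \<le> \<nu> (snd k + n) / \<nu> (snd k)" using \<nu>_pos by (simp add: less_imp_le)
    then have "\<omega> k \<le> \<nu> (snd k + n) / \<nu> (snd k)" "0 \<le> \<omega> k"
      unfolding \<omega>_eq using \<rho>[of k] by (auto simp del: times_divide_eq_right intro: mult_left_le_one_le mult_nonneg_nonneg)
    then show ?thesis using K[of "snd k"] by simp
  qed
  \<comment> \<open>Translation of the full integer lattice, where it is invertible; \<iota> embeds
    the quadrant.\<close>
  define \<sigma> where "\<sigma> = (\<lambda>(p1, p2). (p1 + int m, p2 + int n))"
  have \<sigma>: "bij \<sigma>"
    by (rule o_bij[where g="\<lambda>(p1, p2). (p1 - int m, p2 - int n)"]) (auto simp: \<sigma>_def fun_eq_iff)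
  define \<iota> where "\<iota> = (\<lambda>(k1, k2). (int k1, int k2))"
  have \<iota>: "inj \<iota>" by (auto simp: \<iota>_def inj_def)
  have sub: "subnormal TYPE(((int \<times> int) \<times> nat) ell2) (weighted_shift (\<lambda>(k1, k2). (k1 + m, k2 + n)) \<omega>)"
    by (rule subnormal_weighted_shiftI[OF inj_translation bd \<sigma> \<iota> _ R RR, where u=u])
      (auto simp: \<sigma>_def \<iota>_def nu Ru)
  \<comment> \<open>The fibred index set is countably infinite, so \<open>nat\<close> enumerates
    it.\<close>
  have "bij (from_nat_into (UNIV :: ((int \<times> int) \<times> nat) set))"
    by (rule bij_betw_from_nat_into) (auto simp: finite_prod)
  from subnormal_relabel[OF this sub] show ?thesis
    unfolding lattice_shift_def \<omega>_def by (simp add: case_prod_unfold)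
qed

section \<open>Joint hyponormality\<close>

text \<open>Completing the square. The cross term enters only through |r| \<le> p q, so r may be the
  real part of a complex product.\<close>

lemma quadratic_form_nonneg:
  fixes A B D p q r :: real
  assumes "0 \<le> A" "0 \<le> D" "B\<^sup>2 \<le> A * D" "0 \<le> p" "0 \<le> q" "\<bar>r\<bar> \<le> p * q"
  shows "0 \<le> A * p\<^sup>2 + 2 * B * r + D * q\<^sup>2"
proof -
  have "\<bar>B\<bar> \<le> sqrt (A * D)" using assms(3) by (metis real_sqrt_abs real_sqrt_le_iff)
  then have "\<bar>B * r\<bar> \<le> sqrt (A * D) * (p * q)"
    unfolding abs_mult using assms by (intro mult_mono) auto
  moreover have "0 \<le> (sqrt A * p - sqrt D * q)\<^sup>2" by simp
  then have "2 * (sqrt (A * D) * (p * q)) \<le> A * p\<^sup>2 + D * q\<^sup>2"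
    using assms by (simp add: power2_diff power_mult_distrib real_sqrt_mult mult_ac)
  ultimately show ?thesis by (simp add: abs_le_iff)
qed

lemma infsum_reindex_le_norm:
  assumes "inj f"
  shows "(\<lambda>k. (cmod (ell2_nth x (f k)))\<^sup>2) summable_on UNIV"
    and "(\<Sum>\<^sub>\<infinity>k. (cmod (ell2_nth x (f k)))\<^sup>2) \<le> (norm x)\<^sup>2"
proof -
  have s: "(\<lambda>i. (cmod (ell2_nth x i))\<^sup>2) summable_on range f"
    by (rule summable_on_subset_banach[OF ell2_nth_summable]) simp
  then show "(\<lambda>k. (cmod (ell2_nth x (f k)))\<^sup>2) summable_on UNIV"
    by (simp add: summable_on_reindex[OF assms] o_def)
  have "(\<Sum>\<^sub>\<infinity>k. (cmod (ell2_nth x (f k)))\<^sup>2) = (\<Sum>\<^sub>\<infinity>i\<in>range f. (cmod (ell2_nth x i))\<^sup>2)"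
    by (simp add: infsum_reindex[OF assms] o_def)
  also have "\<dots> \<le> (\<Sum>\<^sub>\<infinity>i. (cmod (ell2_nth x i))\<^sup>2)"
    by (rule infsum_mono2[OF s ell2_nth_summable]) auto
  also have "\<dots> = (norm x)\<^sup>2" by (rule infsumI[OF has_sum_norm_ell2])
  finally show "(\<Sum>\<^sub>\<infinity>k. (cmod (ell2_nth x (f k)))\<^sup>2) \<le> (norm x)\<^sup>2" .
qed

text \<open>The form splits over lattice points k into 2 by 2 forms in the coordinate of u at k +
  (1,0) and that of v at k + (0,1), plus nonnegative boundary terms; \<open>mono1\<close>,
  \<open>mono2\<close> and \<open>det\<close> make each of them positive semidefinite.\<close>

lemma jointly_hyponormal_two_variable_shiftI:
  assumes \<alpha>: "\<And>k. \<bar>\<alpha> k\<bar> \<le> c" and \<beta>: "\<And>k. \<bar>\<beta> k\<bar> \<le> d"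
    and mono1: "\<And>k1 k2. (\<alpha> (k1, k2))\<^sup>2 \<le> (\<alpha> (Suc k1, k2))\<^sup>2"
    and mono2: "\<And>k1 k2. (\<beta> (k1, k2))\<^sup>2 \<le> (\<beta> (k1, Suc k2))\<^sup>2"
    and det: "\<And>k1 k2. (\<alpha> (k1, Suc k2) * \<beta> (Suc k1, k2) - \<alpha> (k1, k2) * \<beta> (k1, k2))\<^sup>2
      \<le> ((\<alpha> (Suc k1, k2))\<^sup>2 - (\<alpha> (k1, k2))\<^sup>2) * ((\<beta> (k1, Suc k2))\<^sup>2 - (\<beta> (k1, k2))\<^sup>2)"
  shows "jointly_hyponormal (two_variable_shift \<alpha> \<beta>)"
proof -
  define e1 e2 :: "nat \<times> nat \<Rightarrow> nat \<times> nat"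
    where "e1 = (\<lambda>(k1, k2). (Suc k1, k2))" and "e2 = (\<lambda>(k1, k2). (k1, Suc k2))"
  have inj1: "inj e1" and inj2: "inj e2" by (auto simp: e1_def e2_def inj_def)
  define T1 T2 where "T1 = weighted_shift e1 \<alpha>" and "T2 = weighted_shift e2 \<beta>"
  have T1n: "ell2_nth (T1 x) (e1 k) = \<alpha> k * ell2_nth x k" for x k
    unfolding T1_def by (simp add: ell2_nth_weighted_shift[OF inj1 \<alpha>] inj1)
  have T2n: "ell2_nth (T2 x) (e2 k) = \<beta> k * ell2_nth x k" for x k
    unfolding T2_def by (simp add: ell2_nth_weighted_shift[OF inj2 \<beta>] inj2)
  have T1z: "ell2_nth (T1 x) k = 0" if "k \<notin> range e1" for x k
    unfolding T1_def using that by (simp add: ell2_nth_weighted_shift[OF inj1 \<alpha>])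
  have T2z: "ell2_nth (T2 x) k = 0" if "k \<notin> range e2" for x k
    unfolding T2_def using that by (simp add: ell2_nth_weighted_shift[OF inj2 \<beta>])
  have A1n: "ell2_nth (adj T1 x) k = \<alpha> k * ell2_nth x (e1 k)" for x k
    unfolding T1_def by (rule ell2_nth_adj_weighted_shift[OF inj1 \<alpha>])
  have A2n: "ell2_nth (adj T2 x) k = \<beta> k * ell2_nth x (e2 k)" for x k
    unfolding T2_def by (rule ell2_nth_adj_weighted_shift[OF inj2 \<beta>])
  have a1: "is_adjoint T1 (adj T1)" unfolding T1_def
    by (rule is_adjoint_adj[OF bounded_clinear_weighted_shift[OF inj1 \<alpha>]])
  have a2: "is_adjoint T2 (adj T2)" unfolding T2_def
    by (rule is_adjoint_adj[OF bounded_clinear_weighted_shift[OF inj2 \<beta>]])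
  note A = a1[unfolded is_adjoint_def, rule_format] a2[unfolded is_adjoint_def, rule_format]
    is_adjoint_sym[OF a1, unfolded is_adjoint_def, rule_format]
    is_adjoint_sym[OF a2, unfolded is_adjoint_def, rule_format]
  have main: "0 \<le> (norm (T1 u))\<^sup>2 + (norm (T2 v))\<^sup>2 + 2 * inner (T1 v) (T2 u)
      - (norm (adj T1 u + adj T2 v))\<^sup>2" for u v
  proof -
    define U W where "U k = ell2_nth u (e1 k)" and "W k = ell2_nth v (e2 k)" for k
    have comm: "e1 (e2 k) = e2 (e1 k)" for k by (cases k) (simp add: e1_def e2_def)
    let ?f1 = "\<lambda>k. (cmod (\<alpha> (e1 k) * U k))\<^sup>2" and ?f2 = "\<lambda>k. (cmod (\<beta> (e2 k) * W k))\<^sup>2"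
    let ?f3 = "\<lambda>k. Re (\<alpha> (e2 k) * W k * cnj (\<beta> (e1 k) * U k))"
    let ?f4 = "\<lambda>k. (cmod (\<alpha> k * U k + \<beta> k * W k))\<^sup>2"
    \<comment> \<open>Only the coordinates of \<open>T1 u\<close> at k + (2,0) are kept; the others
      contribute nonnegative terms.\<close>
    have s1: "?f1 summable_on UNIV" and l1: "infsum ?f1 UNIV \<le> (norm (T1 u))\<^sup>2"
      using infsum_reindex_le_norm[of "\<lambda>k. e1 (e1 k)" "T1 u"] inj_compose[OF inj1 inj1]
      by (simp_all add: T1n U_def o_def)
    have s2: "?f2 summable_on UNIV" and l2: "infsum ?f2 UNIV \<le> (norm (T2 v))\<^sup>2"
      using infsum_reindex_le_norm[of "\<lambda>k. e2 (e2 k)" "T2 v"] inj_compose[OF inj2 inj2]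
      by (simp_all add: T2n W_def o_def)
    have h3: "(?f3 has_sum inner (T1 v) (T2 u)) UNIV"
    proof -
      let ?g = "\<lambda>j. ell2_nth (T1 v) j * cnj (ell2_nth (T2 u) j)"
      have i12: "inj (e1 \<circ> e2)" by (rule inj_compose[OF inj1 inj2])
      \<comment> \<open>A coordinate contributes only if it lies in both ranges, that is, if both
        its components are positive.\<close>
      have z: "?g j = 0" if "j \<notin> range (e1 \<circ> e2)" for j
      proof (cases "j \<in> range e1 \<and> j \<in> range e2")
        case True
        then obtain i k where ik: "j = e1 i" "j = e2 k" by blast
        obtain i1 i2 k1 k2 where p: "i = (i1, i2)" "k = (k1, k2)" by (metis surj_pair)
        then have "j = (Suc i1, Suc k2)" using ik by (auto simp: e1_def e2_def)
        then have "j = (e1 \<circ> e2) (i1, k2)" by (simp add: e1_def e2_def)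
        then show ?thesis using that by blast
      qed (use T1z[of j v] T2z[of j u] in auto)
      have "(?g has_sum cinner (T1 v) (T2 u)) (range (e1 \<circ> e2))"
        by (rule has_sum_cong_neutral[THEN iffD1, rotated -1, OF has_sum_cinner_ell2]) (use z in auto)
      then have "((?g \<circ> (e1 \<circ> e2)) has_sum cinner (T1 v) (T2 u)) UNIV"
        unfolding has_sum_reindex[OF i12] .
      from has_sum_Re[OF this] show ?thesis
        unfolding inner_eq_Re_cinner by (simp add: o_def T1n U_def W_def) (simp add: comm T2n)
    qed
    have h4: "(?f4 has_sum (norm (adj T1 u + adj T2 v))\<^sup>2) UNIV"
      using has_sum_norm_ell2[of "adj T1 u + adj T2 v"]
      by (simp add: plus_ell2.rep_eq A1n A2n U_def W_def)
    have pointwise: "0 \<le> ?f1 k + ?f2 k + 2 * ?f3 k - ?f4 k" for k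
    proof -
      obtain k1 k2 where k: "k = (k1, k2)" by (metis surj_pair)
      define r where "r = Re (W k * cnj (U k))"
      have f1: "?f1 k = (\<alpha> (e1 k))\<^sup>2 * (cmod (U k))\<^sup>2" and f2: "?f2 k = (\<beta> (e2 k))\<^sup>2 * (cmod (W k))\<^sup>2"
        by (simp_all add: norm_mult power_mult_distrib)
      have f3: "?f3 k = \<alpha> (e2 k) * \<beta> (e1 k) * r" by (simp add: r_def algebra_simps)
      have f4: "?f4 k = (\<alpha> k)\<^sup>2 * (cmod (U k))\<^sup>2 + (\<beta> k)\<^sup>2 * (cmod (W k))\<^sup>2 + 2 * (\<alpha> k * \<beta> k) * r"
        unfolding cmod_power2 r_def by (simp add: power2_eq_square algebra_simps)
      have "\<bar>r\<bar> \<le> cmod (U k) * cmod (W k)"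
        using abs_Re_le_cmod[of "W k * cnj (U k)"] by (simp add: r_def norm_mult mult.commute)
      then have "0 \<le> ((\<alpha> (e1 k))\<^sup>2 - (\<alpha> k)\<^sup>2) * (cmod (U k))\<^sup>2
        + 2 * (\<alpha> (e2 k) * \<beta> (e1 k) - \<alpha> k * \<beta> k) * r + ((\<beta> (e2 k))\<^sup>2 - (\<beta> k)\<^sup>2) * (cmod (W k))\<^sup>2"
        using mono1[of k1 k2] mono2[of k1 k2] det[of k1 k2]
        by (intro quadratic_form_nonneg) (auto simp: k e1_def e2_def)
      then show ?thesis unfolding f1 f2 f3 f4 by (simp add: algebra_simps)
    qed
    have "((\<lambda>k. ?f1 k + ?f2 k + 2 * ?f3 k - ?f4 k) has_sum
      (infsum ?f1 UNIV + infsum ?f2 UNIV + 2 * inner (T1 v) (T2 u) - (norm (adj T1 u + adj T2 v))\<^sup>2)) UNIV"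
      unfolding diff_conv_add_uminus
      by (intro has_sum_add has_sum_cmult_right has_sum_infsum s1 s2 h3)
        (simp add: has_sum_uminus h4)
    from has_sum_nonneg[OF this pointwise] show ?thesis using l1 l2 by simp
  qed
  have "0 \<le> cinner (commutator (adj T1) T1 u + commutator (adj T2) T1 v) u
     + cinner (commutator (adj T1) T2 u + commutator (adj T2) T2 v) v" for u v
  proof -
    have cr: "cinner x y + cinner y x = complex_of_real (2 * inner x y)" for x y :: "(nat \<times> nat) ell2"
      using complex_add_cnj[of "cinner x y"] cinner_commute[of y x] by (simp add: inner_eq_Re_cinner)
    have "cinner (commutator (adj T1) T1 u + commutator (adj T2) T1 v) u
     + cinner (commutator (adj T1) T2 u + commutator (adj T2) T2 v) v
     = cinner (T1 u) (T1 u) + cinner (T2 v) (T2 v) + (cinner (T1 v) (T2 u) + cinner (T2 u) (T1 v))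
       - cinner (adj T1 u + adj T2 v) (adj T1 u + adj T2 v)"
      by (simp add: commutator_def cinner_add_left cinner_add_right cinner_diff_left A algebra_simps)
    also have "\<dots> = complex_of_real ((norm (T1 u))\<^sup>2 + (norm (T2 v))\<^sup>2 + 2 * inner (T1 v) (T2 u)
       - (norm (adj T1 u + adj T2 v))\<^sup>2)"
      unfolding cr cinner_self_norm by simp
    finally show ?thesis using main[of u v] by (simp add: less_eq_complex_def)
  qed
  then show ?thesis
    unfolding jointly_hyponormal_def two_variable_shift_def positive_operator_matrix_def
    using T1_def T2_def e1_def e2_def by simp
qed

section \<open>Vectors in the kernel of a normal operator\<close>

lemma norm_adj_eq:
  fixes N :: "'a::chilbert_space \<Rightarrow> 'a"
  assumes "normal_operator N"
  shows "norm (adj N x) = norm (N x)"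
proof -
  have b: "bounded_clinear N" and c: "N (adj N x) = adj N (N x)" for x
    using assms by (auto simp: normal_operator_def fun_eq_iff)
  note A = is_adjoint_adj[OF b, unfolded is_adjoint_def, rule_format]
  have "cinner (adj N x) (adj N x) = cinner (N x) (N x)"
    using is_adjoint_sym[OF is_adjoint_adj[OF b]] unfolding A[symmetric] c by (simp add: is_adjoint_def)
  then have "(norm (adj N x))\<^sup>2 = (norm (N x))\<^sup>2"
    unfolding cinner_self_norm by (simp only: of_real_eq_iff)
  then show ?thesis by simp
qed

text \<open>Expand the squared norm of \<open>adj N (N g) - g\<close>. Normality replaces the norm
  of \<open>adj N (N g)\<close> by that of \<open>N (N g)\<close>, so the three terms are 1, -2 and
  1 times the squared norm of g.\<close>

lemma normal_operator_isometric_twice: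
  fixes N :: "'a::chilbert_space \<Rightarrow> 'a"
  assumes N: "normal_operator N" and "norm (N g) = norm g" "norm (N (N g)) = norm g"
  shows "adj N (N g) = g"
proof -
  have b: "bounded_clinear N" using N by (simp add: normal_operator_def)
  have "inner (adj N (N g)) g = (norm (N g))\<^sup>2"
    using is_adjoint_sym[OF is_adjoint_adj[OF b]]
    by (simp add: is_adjoint_def inner_eq_Re_cinner power2_norm_eq_inner)
  then have "(norm (adj N (N g) - g))\<^sup>2 = (norm (adj N (N g)))\<^sup>2 - 2 * (norm (N g))\<^sup>2 + (norm g)\<^sup>2"
    unfolding power2_norm_eq_inner by (simp add: inner_diff_left inner_diff_right inner_commute)
  then show ?thesis by (simp add: norm_adj_eq[OF N] assms)
qed

text \<open>Let \<open>P\<close> be the spectral projection of \<open>N\<^sub>1\<close> at 0. The hypothesis says that \<open>N\<^sub>1\<^sup>* N\<^sub>1\<close> acts on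
  the vectors at hand as \<open>1 - P\<close>, and \<open>P W\<close> is the vector sought. Arguing with the kernel and the
  range of \<open>N\<^sub>1\<close> avoids Fuglede's theorem.\<close>

lemma commuting_normal_kernel_part:
  fixes N1 N2 :: "'a::chilbert_space \<Rightarrow> 'a"
  assumes N1: "normal_operator N1" and N2: "bounded_clinear N2" and com: "N1 \<circ> N2 = N2 \<circ> N1"
    and iso: "\<And>l. norm (N1 (N1 ((N2 ^^ l) W))) = norm (N1 ((N2 ^^ l) W))"
      "\<And>l. norm (N1 (N1 (N1 ((N2 ^^ l) W)))) = norm (N1 ((N2 ^^ l) W))"
  obtains f where "\<And>l. (norm ((N2 ^^ l) f))\<^sup>2 = (norm ((N2 ^^ l) W))\<^sup>2 - (norm (N1 ((N2 ^^ l) W)))\<^sup>2"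
proof
  define A where "A = adj N1"
  \<comment> \<open>With \<open>adj N1 (N1 W)\<close> in the role of (1 - P) W, this is P W.\<close>
  define f where "f = W - A (N1 W)"
  have b: "bounded_clinear N1" and c: "N1 (A x) = A (N1 x)" for x
    using N1 by (auto simp: normal_operator_def fun_eq_iff A_def)
  have bA: "bounded_clinear A" unfolding A_def by (rule bounded_clinear_adj[OF b])
  have adj: "cinner (N1 x) y = cinner x (A y)" for x y
    using is_adjoint_adj[OF b] by (simp add: A_def is_adjoint_def)
  have lin: "N1 (x - y) = N1 x - N1 y" "A (x - y) = A x - A y" "(N2 ^^ l) (x - y) = (N2 ^^ l) x - (N2 ^^ l) y"
    "(N2 ^^ l) 0 = 0" for x y l
    using b bA bounded_clinear_funpow[OF N2, of l] by (auto simp: bounded_clinear_def linear_simps)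
  have ker: "A x = 0" if "N1 x = 0" for x
    using norm_adj_eq[OF N1, of x] that by (simp add: A_def)
  have com': "N1 ((N2 ^^ l) x) = (N2 ^^ l) (N1 x)" for l x
    using com by (induction l) (auto simp: fun_eq_iff)
  have fix1: "A (N1 (N1 ((N2 ^^ l) W))) = N1 ((N2 ^^ l) W)" for l
    unfolding A_def by (rule normal_operator_isometric_twice[OF N1]) (use iso in auto)
  have N1f: "N1 f = 0" using fix1[of 0] by (simp add: f_def lin c)
  fix l
  \<comment> \<open>\<open>(N2 ^^ l) W\<close> is split into z in the kernel of N1 and h in its
    range; normality makes the two orthogonal.\<close>
  define z where "z = (N2 ^^ l) f"
  define h where "h = (N2 ^^ l) W - z"
  define y where "y = (N2 ^^ l) (A W)"
  have z0: "N1 z = 0" by (simp add: z_def com' N1f lin)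
  have hy: "h = N1 y"
    by (simp add: h_def z_def y_def f_def lin com' c)
  have N1h: "N1 h = N1 ((N2 ^^ l) W)" by (simp add: h_def lin z0)
  have hz: "cinner h z = 0" by (simp add: hy adj ker[OF z0])
  \<comment> \<open>d lies in the kernel and in the range of N1, which for a normal operator meet
    only in 0. Then d = 0 makes h and \<open>N1 h\<close> equally long.\<close>
  define d where "d = A (N1 h) - h"
  have "N1 d = 0"
    using fix1[of l] by (simp add: d_def lin c N1h)
  then have Ad: "A d = 0" by (rule ker)
  have "cinner d d = cinner (N1 (A h - y)) d" by (simp add: d_def lin c hy)
  then have "cinner d d = 0" by (simp add: adj Ad)
  then have "A (N1 h) = h" by (simp add: cinner_self_norm d_def)
  then have "cinner h h = cinner (N1 h) (N1 h)" by (simp add: adj)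
  then have nh: "(norm h)\<^sup>2 = (norm (N1 ((N2 ^^ l) W)))\<^sup>2"
    unfolding cinner_self_norm N1h by (simp only: of_real_eq_iff)
  have "(norm ((N2 ^^ l) W))\<^sup>2 = (norm (h + z))\<^sup>2" by (simp add: h_def)
  also have "\<dots> = (norm h)\<^sup>2 + (norm z)\<^sup>2"
    using inner_eq_Re_cinner[of h z] hz unfolding power2_norm_eq_inner
    by (simp add: inner_add_left inner_add_right inner_commute[of z h])
  finally show "(norm ((N2 ^^ l) f))\<^sup>2 = (norm ((N2 ^^ l) W))\<^sup>2 - (norm (N1 ((N2 ^^ l) W)))\<^sup>2"
    by (simp add: nh z_def)
qed

text \<open>The spectral measure of \<open>N\<^sup>* N\<close> at \<open>f\<close> is \<open>D \<delta>\<^sub>0 + C dt/t\<close>, where \<open>D\<close> is the difference of the two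
  sides of the claim. Integrating \<open>(1 - t)\<^bsup>2m\<^esup>\<close> against it gives a nonnegative number that tends to \<open>D\<close>.\<close>

lemma normal_moment_bound:
  fixes N :: "'a::chilbert_space \<Rightarrow> 'a"
  assumes N: "normal_operator N" and C: "0 \<le> C"
    and mo: "\<And>l. l \<ge> 1 \<Longrightarrow> (norm ((N ^^ l) f))\<^sup>2 = C * mom l"
  shows "C * ln 3 \<le> (norm f)\<^sup>2"
proof -
  define A where "A = adj N \<circ> N"
  define B where "B x = x - A x" for x
  define D where "D = (norm f)\<^sup>2 - C * ln 3"
  define I where "I m l = integral {1/2..3/2::real} (\<lambda>t. (1 - t) ^ m * (t ^ l / t))" for m l :: nat
  have b: "bounded_clinear N" and c: "N (adj N x) = adj N (N x)" for x
    using N by (auto simp: normal_operator_def fun_eq_iff)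
  have AA: "is_adjoint A A"
    unfolding A_def by (intro is_adjoint_comp is_adjoint_sym[OF is_adjoint_adj] is_adjoint_adj b)
  have bA: "bounded_clinear A" unfolding A_def by (intro bounded_clinear_comp bounded_clinear_adj b)
  have BB: "is_adjoint B B"
    using AA by (simp add: is_adjoint_def B_def cinner_diff_left cinner_diff_right)
  have B_diff: "B (x - y) = B x - B y" for x y
    using bA by (simp add: B_def bounded_clinear_def linear_simps)
  have Bpow_diff: "(B ^^ m) (x - y) = (B ^^ m) x - (B ^^ m) y" for m x y
    by (induction m) (auto simp: B_diff)
  have cpow: "(N ^^ l) (adj N x) = adj N ((N ^^ l) x)" for l x
    by (induction l) (auto simp: c)
  have Apow: "(A ^^ l) x = (adj N ^^ l) ((N ^^ l) x)" for l x
  proof (induction l arbitrary: x)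
    case (Suc l)
    have "(A ^^ Suc l) x = (adj N ^^ l) ((N ^^ l) (adj N (N x)))"
      by (simp only: funpow_Suc_right o_apply Suc) (simp add: A_def)
    also have "\<dots> = (adj N ^^ Suc l) ((N ^^ Suc l) x)"
      by (simp only: cpow funpow_Suc_right o_apply)
    finally show ?case .
  qed simp
  have base: "inner ((A ^^ l) f) f = (norm ((N ^^ l) f))\<^sup>2" for l
    using is_adjoint_funpow[OF is_adjoint_sym[OF is_adjoint_adj[OF b]], of l]
    by (simp add: Apow power2_norm_eq_inner inner_eq_Re_cinner is_adjoint_def)
  have int: "(\<lambda>t. (1 - t) ^ m * (t ^ l / t)) integrable_on {1/2..3/2::real}" for m l
    by (intro integrable_continuous_interval continuous_intros) auto
  have I_Suc: "I (Suc m) l = I m l - I m (Suc l)" for m l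
    unfolding I_def integral_diff[OF int int, symmetric]
    by (rule integral_cong) (auto simp: field_simps)
  \<comment> \<open>The integral of (1 - t)^m t^l against the measure described above; only l = 0
    sees the atom. Splitting off one factor B = 1 - A raises l in one of the two terms, so the
    induction runs over all l at once.\<close>
  have val: "inner ((B ^^ m) ((A ^^ l) f)) f = (if l = 0 then D else 0) + C * I m l" for m l
  proof (induction m arbitrary: l)
    case 0
    have "I 0 l = mom l" by (simp add: I_def mom_def)
    then show ?case using mo[of l] by (cases "l = 0") (auto simp: base D_def mom_0 power2_norm_eq_inner)
  next
    case (Suc m)
    have "(B ^^ Suc m) ((A ^^ l) f) = (B ^^ m) ((A ^^ l) f) - (B ^^ m) ((A ^^ Suc l) f)"
      by (simp only: funpow_Suc_right[of m B] o_apply) (simp add: B_def Bpow_diff)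
    then have "inner ((B ^^ Suc m) ((A ^^ l) f)) f
        = inner ((B ^^ m) ((A ^^ l) f)) f - inner ((B ^^ m) ((A ^^ Suc l) f)) f"
      by (simp only: inner_diff_left)
    also have "\<dots> = (if l = 0 then D else 0) + C * I (Suc m) l"
      unfolding Suc I_Suc by (simp add: algebra_simps)
    finally show ?case .
  qed
  have ge: "0 \<le> D + C * (2 * (1/4) ^ m)" for m
  proof -
    \<comment> \<open>B is self-adjoint, so the even exponent 2m produces a squared norm.\<close>
    have "0 \<le> inner ((B ^^ m) f) ((B ^^ m) f)" by simp
    also have "\<dots> = inner ((B ^^ (2 * m)) ((A ^^ 0) f)) f"
      using is_adjoint_funpow[OF BB, of m]
      by (simp add: inner_eq_Re_cinner is_adjoint_def mult_2 funpow_add)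
    also have "\<dots> = D + C * I (2 * m) 0" unfolding val by simp
    also have "I (2 * m) 0 \<le> integral {1/2..3/2::real} (\<lambda>t. 2 * (1/4) ^ m)"
      unfolding I_def
    proof (rule integral_le[OF int])
      fix t :: real assume t: "t \<in> {1/2..3/2}"
      \<comment> \<open>On the interval |1 - t| \<le> 1/2 and 1/t \<le> 2, whence the decay (1/4)^m
        and the factor 2.\<close>
      have "\<bar>1 - t\<bar> \<le> 1/2" using t by (auto simp: abs_if)
      then have "(1 - t)\<^sup>2 \<le> (1/2)\<^sup>2" by (metis abs_le_square_iff abs_of_pos half_gt_zero_iff zero_less_one)
      then have "((1 - t)\<^sup>2) ^ m \<le> (1/4) ^ m" by (intro power_mono) (auto simp: power2_eq_square)
      moreover have "t ^ 0 / t \<le> 2" using t by (auto simp: divide_simps)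
      ultimately have "((1 - t)\<^sup>2) ^ m * (t ^ 0 / t) \<le> (1/4) ^ m * 2"
        using t by (intro mult_mono) auto
      then show "(1 - t) ^ (2 * m) * (t ^ 0 / t) \<le> 2 * (1/4) ^ m" by (simp only: power_mult mult.commute[of 2 "(1/4) ^ m"])
    qed auto
    also have "integral {1/2..3/2::real} (\<lambda>t. 2 * (1/4) ^ m) = 2 * (1/4) ^ m" by simp
    finally show ?thesis using C by (simp add: mult_left_mono)
  qed
  have "(\<lambda>m. D + C * (2 * (1/4) ^ m)) \<longlonglongrightarrow> D + C * (2 * 0)"
    by (intro tendsto_intros LIMSEQ_power_zero) auto
  then have "0 \<le> D + C * (2 * 0)" by (rule LIMSEQ_le_const) (use ge in auto)
  then show ?thesis by (simp add: D_def)
qed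

section \<open>The family of pairs\<close>

lemma lattice_shift_ket:
  assumes G: "\<And>k. 0 < G k" and bd: "\<exists>c. \<forall>k1 k2. G (k1 + m, k2 + n) / G (k1, k2) \<le> c"
  shows "lattice_shift G m n (ket (0, 0)) = complex_of_real (G (m, n) / G (0, 0)) *\<^sub>C ket (m, n)"
proof -
  obtain c where "\<And>k1 k2. G (k1 + m, k2 + n) / G (k1, k2) \<le> c" using bd by blast
  then have c: "\<bar>(\<lambda>(k1, k2). G (k1 + m, k2 + n) / G (k1, k2)) k\<bar> \<le> c" for k
    using G by (cases k) (simp add: abs_divide abs_of_pos)
  show ?thesis unfolding lattice_shift_def weighted_shift_ket[OF inj_translation c] by simp
qed

text \<open>Quotients of consecutive moments of dt are the squares of the weights. The factor 1/ln 3
  cancels in the quotient of \<nu>, and positivity selects the root.\<close>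

lemma berger_weights:
  assumes pos: "\<And>k. k \<ge> 1 \<Longrightarrow> \<beta> k > 0"
    and berger: "is_berger_measure (\<lambda>n. \<beta> (Suc n)) (density lborel (indicator {1/2..3/2}))"
    and k: "k \<ge> 1"
  shows "\<beta> k = \<nu> (Suc k) / \<nu> k"
proof -
  have mo: "(\<Prod>i<l. (\<beta> (Suc i))\<^sup>2) = mom (Suc l)" for l
  proof -
    have "(\<Prod>i<l. (\<beta> (Suc i))\<^sup>2) = (\<integral>s. s ^ l \<partial>density lborel (\<lambda>x. ennreal (indicator {1/2..3/2} x)))"
      using berger by (simp add: is_berger_measure_def ennreal_indicator)
    also have "\<dots> = (\<integral>s. indicator {1/2..3/2} s *\<^sub>R s ^ l \<partial>lborel)"
      by (rule integral_density) auto
    also have "\<dots> = (\<integral>s. s ^ l * indicator {1/2..3/2} s \<partial>lborel)" by (simp add: mult.commute)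
    also have "\<dots> = mom (Suc l)" unfolding mom_Suc by (rule integral_power) simp
    finally show ?thesis .
  qed
  obtain l where l: "k = Suc l" using k by (cases k) auto
  have "mom (Suc k) = mom k * (\<beta> k)\<^sup>2"
    using mo[of "Suc l"] mo[of l] by (simp add: l)
  then have "(\<beta> k)\<^sup>2 = (\<nu> (Suc k) / \<nu> k)\<^sup>2"
    using mom_pos[of k] by (simp add: power_divide \<nu>_power2)
  then show ?thesis
    using pos[OF k] \<nu>_pos[of k] \<nu>_pos[of "Suc k"] by (simp add: power2_eq_iff_nonneg less_imp_le)
qed

text \<open>In each of the four regions cut out by the coordinate axes, the moments of the pair are those of
  \<open>shift(\<nu>\<^sub>1/\<nu>\<^sub>0, \<nu>\<^sub>2/\<nu>\<^sub>1, \<dots>)\<close> in the second variable, up to a constant factor.\<close>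

definition region_factor :: "real \<Rightarrow> real \<Rightarrow> real \<Rightarrow> nat \<times> nat \<Rightarrow> real" where
  "region_factor x a y = (\<lambda>(k1, k2). if k2 = 0 then (if k1 = 0 then 1 else x)
     else (if k1 = 0 then 1 else a) * (y * sqrt (ln 3)))"

text \<open>The value at (k1, k2) is the norm of T1^k1 T2^k2 applied to the basis vector at the
  origin.\<close>

definition root_moment :: "real \<Rightarrow> real \<Rightarrow> real \<Rightarrow> nat \<times> nat \<Rightarrow> real" where
  "root_moment x a y = (\<lambda>(k1, k2). region_factor x a y (k1, k2) * \<nu> k2)"

theorem mainTheorem3:
  fixes \<beta> :: "nat \<Rightarrow> real" and a x s M :: real
  assumes "\<And>k. k \<ge> 1 \<Longrightarrow> \<beta> k > 0"
    and "is_berger_measure (\<lambda>n. \<beta> (Suc n)) (density lborel (indicator {1/2..3/2}))"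
    and "0 < a" and "a < x" and "x < 1"
    and "s = sqrt (1 / ln 3 * ((1 - x\<^sup>2) / (1 - a\<^sup>2)))"
    and "M = min (x * sqrt (1 - x\<^sup>2) / sqrt (x\<^sup>2 + a ^ 4 - 2 * a\<^sup>2 * x\<^sup>2)) (sqrt (1 / ln 3))"
  shows "s < M \<and>
    (\<forall>y T1 T2. s < y \<longrightarrow> y \<le> M \<longrightarrow>
      (T1, T2) = two_variable_shift (weight_alpha x a) (weight_beta \<beta> x a y) \<longrightarrow>
        (T1, T2) \<in> H_1 TYPE(nat ell2) \<and>
        (T1, T2) \<notin> H_infinity TYPE('k::chilbert_space) \<and>
        (\<forall>m\<ge>1. \<forall>n\<ge>1. subnormal TYPE(nat ell2) ((T1 ^^ m) \<circ> (T2 ^^ n))))"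
proof -
  have x: "0 < x" using assms by simp
  have ax: "a\<^sup>2 < x\<^sup>2" using assms by (simp add: power_strict_mono)
  have x1: "x\<^sup>2 < 1" using x assms by (simp add: abs_square_less_1)
  have a1: "a\<^sup>2 < 1" using ax x1 by simp
  have ln3: "1 \<le> ln (3::real)" using exp_le by (simp add: ln_ge_iff)
  define Q where "Q = x\<^sup>2 + a ^ 4 - 2 * a\<^sup>2 * x\<^sup>2"
  \<comment> \<open>This form shows Q > 0 and later evaluates the determinant at the origin.\<close>
  have Q1: "Q = (x\<^sup>2 - a\<^sup>2)\<^sup>2 + x\<^sup>2 * (1 - x\<^sup>2)"
    by (simp add: Q_def power2_eq_square power4_eq_xxxx algebra_simps)
  have Q0: "0 < Q" unfolding Q1 using x x1 by (intro add_nonneg_pos mult_pos_pos) auto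
  have Q2: "Q < x\<^sup>2 * (1 - a\<^sup>2)"
  proof -
    have "0 < a\<^sup>2 * (x\<^sup>2 - a\<^sup>2)" using ax assms by simp
    then show ?thesis by (simp add: Q_def power2_eq_square power4_eq_xxxx algebra_simps)
  qed
  have s0: "0 \<le> s" using assms(6) x1 a1 by simp
  have s2: "s\<^sup>2 = (1 - x\<^sup>2) / (1 - a\<^sup>2) / ln 3" using assms(6) x1 a1 by simp
  define M1 where "M1 = x * sqrt (1 - x\<^sup>2) / sqrt Q"
  have M1: "0 \<le> M1" "M1\<^sup>2 = x\<^sup>2 * (1 - x\<^sup>2) / Q"
    using x x1 Q0 by (auto simp: M1_def power_divide power_mult_distrib)
  have M: "M = min M1 (sqrt (1 / ln 3))" using assms(7) by (simp add: M1_def Q_def)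
  have "s < M1"
  proof (rule power2_less_imp_less[OF _ M1(1)])
    \<comment> \<open>After squaring and cancelling 1 - x^2, the claim s < M1 is Q < x^2 (1 - a^2)
      ln 3.\<close>
    have "(1 - x\<^sup>2) * Q < (1 - x\<^sup>2) * (x\<^sup>2 * (1 - a\<^sup>2))" using Q2 x1 by simp
    also have "\<dots> \<le> (1 - x\<^sup>2) * (x\<^sup>2 * (1 - a\<^sup>2)) * ln 3" using ln3 x1 a1 x by simp
    finally have "(1 - x\<^sup>2) * Q < x\<^sup>2 * (1 - x\<^sup>2) * ((1 - a\<^sup>2) * ln 3)" by (simp add: mult_ac)
    then show "s\<^sup>2 < M1\<^sup>2" unfolding s2 M1(2) using Q0 a1 ln3 by (simp add: divide_less_eq less_divide_eq mult_ac)
  qed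
  moreover have "s < sqrt (1 / ln 3)"
  proof (rule power2_less_imp_less)
    have "(1 - x\<^sup>2) / (1 - a\<^sup>2) < 1" using ax a1 by simp
    then have "(1 - x\<^sup>2) / (1 - a\<^sup>2) / ln 3 < 1 / ln 3" by (rule divide_strict_right_mono) simp
    then show "s\<^sup>2 < (sqrt (1 / ln 3))\<^sup>2" unfolding s2 by simp
  qed (use ln3 in simp)
  ultimately have sM: "s < M" by (simp add: M)
  have "(T1, T2) \<in> H_1 TYPE(nat ell2) \<and> (T1, T2) \<notin> H_infinity TYPE('k) \<and>
        (\<forall>m\<ge>1. \<forall>n\<ge>1. subnormal TYPE(nat ell2) ((T1 ^^ m) \<circ> (T2 ^^ n)))"
    if y1: "s < y" and y2: "y \<le> M"
      and T: "(T1, T2) = two_variable_shift (weight_alpha x a) (weight_beta \<beta> x a y)" for y T1 T2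
  proof -

    \<comment> \<open>The pair as shifts with telescoping weights\<close>
    have y0: "0 < y" using y1 s0 by simp
    \<comment> \<open>Normalised so that \<open>Y * \<nu> 1 = y\<close>, since
      \<open>\<nu> 1\<close> is 1/sqrt(ln 3). The second term of M gives Y \<le> 1, which makes g
      decrease when k2 leaves 0.\<close>
    define Y where "Y = y * sqrt (ln 3)"
    have Y0: "0 < Y" using y0 ln3 by (simp add: Y_def)
    have Yy: "Y\<^sup>2 = y\<^sup>2 * ln 3" using ln3 by (simp add: Y_def power_mult_distrib)
    have "y * sqrt (ln 3) \<le> sqrt (1 / ln 3) * sqrt (ln 3)"
      using y2 M ln3 by (intro mult_right_mono) auto
    then have Y1: "Y \<le> 1" using ln3 by (simp add: Y_def real_sqrt_divide)
    have yQ: "y\<^sup>2 * Q \<le> x\<^sup>2 * (1 - x\<^sup>2)"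
    proof -
      have "y\<^sup>2 \<le> M1\<^sup>2" using y2 y0 M by (intro power_mono) auto
      then show ?thesis unfolding M1(2) using Q0 by (simp add: le_divide_eq)
    qed
    define g where "g = region_factor x a y"
    have g: "g (k1, k2) = (if k2 = 0 then (if k1 = 0 then 1 else x) else (if k1 = 0 then 1 else a) * Y)"
      for k1 k2 by (simp add: g_def region_factor_def Y_def)
    have gpos: "0 < g k" for k using x assms(3) Y0 by (cases k) (simp add: g)
    have aY: "a * Y \<le> x" "a * Y \<le> Y" "x \<le> 1"
      using Y0 assms(3-5) mult_left_mono[OF Y1, of a] mult_right_mono[of a 1 Y] by linarith+
    have gdec: "g (k1 + m, k2 + n) \<le> g (k1, k2)" for k1 k2 m n
      using aY Y1 by (auto simp: g intro: order_trans)
    \<comment> \<open>A coordinate that moves is positive after one translation by (m, n), so a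
      second translation stays in the same region.\<close>
    have gstab: "g (k1 + m + m, k2 + n + n) = g (k1 + m, k2 + n)" for k1 k2 m n
      by (auto simp: g)
    define G where "G = root_moment x a y"
    have Geq: "G = (\<lambda>(k1, k2). g (k1, k2) * \<nu> k2)" by (simp add: G_def root_moment_def g_def)
    have Gpos: "0 < G k" for k using gpos \<nu>_pos by (cases k) (simp add: Geq)
    have Gbd: "\<exists>c. \<forall>k1 k2. G (k1 + m, k2 + n) / G (k1, k2) \<le> c" for m n
    proof -
      obtain K where K: "\<And>l. \<nu> (l + n) / \<nu> l \<le> K" using \<nu>_ratio_bounded[of n] by blast
      have "G (k1 + m, k2 + n) / G (k1, k2) \<le> K" for k1 k2
      proof -
        have "G (k1 + m, k2 + n) / G (k1, k2) = g (k1 + m, k2 + n) / g (k1, k2) * (\<nu> (k2 + n) / \<nu> k2)"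
          by (simp add: Geq)
        also have "\<dots> \<le> 1 * (\<nu> (k2 + n) / \<nu> k2)"
          using gdec[of k1 m k2 n] gpos \<nu>_pos by (intro mult_right_mono) (auto simp: less_imp_le)
        finally show ?thesis using K[of k2] by simp
      qed
      then show ?thesis by blast
    qed
    have \<nu>1: "Y * \<nu> 1 = y" 
      using ln3 by (simp add: Y_def \<nu>_def mom_1[simplified] real_sqrt_divide)
    have alpha: "weight_alpha x a = (\<lambda>(k1, k2). G (k1 + 1, k2 + 0) / G (k1, k2))"
    proof (rule ext, clarify)
      fix k1 k2 :: nat
      show "weight_alpha x a (k1, k2) = G (k1 + 1, k2 + 0) / G (k1, k2)"
        using \<nu>_pos[of k2] x assms(3) Y0 by (simp add: weight_alpha_def Geq g)
    qed
    have beta: "weight_beta \<beta> x a y = (\<lambda>(k1, k2). G (k1 + 0, k2 + 1) / G (k1, k2))"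
    proof (rule ext, clarify)
      fix k1 k2 :: nat
      show "weight_beta \<beta> x a y (k1, k2) = G (k1 + 0, k2 + 1) / G (k1, k2)"
      proof (cases "k2 = 0")
        case True
        then show ?thesis using \<nu>1 x by (simp add: weight_beta_def Geq g \<nu>_0 mult.assoc)
      next
        case False
        then show ?thesis
          using berger_weights[OF assms(1,2), of k2] assms(3) Y0 by (simp add: weight_beta_def Geq g)
      qed
    qed
    have T1: "T1 = lattice_shift G 1 0" and T2: "T2 = lattice_shift G 0 1"
      using T alpha beta by (auto simp: two_variable_shift_def lattice_shift_def case_prod_unfold)
    note comp = lattice_shift_comp[of G, OF Gpos Gbd] and pow = lattice_shift_funpow[of G, OF Gpos Gbd]
    have T12: "(T1 ^^ m) \<circ> (T2 ^^ n) = lattice_shift G m n" for m n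
      by (simp add: T1 T2 pow comp)
    \<comment> \<open>m and n may be 0 here, which covers T1 and T2 themselves.\<close>
    have sub: "subnormal TYPE(nat ell2) (lattice_shift G m n)" for m n
      unfolding Geq by (rule subnormal_lattice_shift[OF gpos gdec gstab])
    have com: "T1 \<circ> T2 = T2 \<circ> T1" by (simp add: T1 T2 comp)
    have H0: "(T1, T2) \<in> H_0 TYPE(nat ell2)"
      using sub com by (simp add: H_0_def T1 T2)

    \<comment> \<open>Joint hyponormality\<close>
    have hyp: "jointly_hyponormal (T1, T2)"
    proof -
      let ?\<alpha> = "weight_alpha x a" and ?\<beta> = "weight_beta \<beta> x a y"
      have \<alpha>: "\<bar>?\<alpha> k\<bar> \<le> 1" for k using x assms by (cases k) (simp add: weight_alpha_def)
      have \<beta>eq: "\<beta> k2 = \<nu> (Suc k2) / \<nu> k2" if "k2 \<ge> 1" for k2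
        using berger_weights[OF assms(1,2) that] .
      \<comment> \<open>The mean of dt on [1/2, 3/2], which is the square of
        \<open>\<beta> 1\<close>.\<close>
      have "mom 2 = 1" using mom_Suc[of 1] by (simp add: numeral_2_eq_2 power2_eq_square)
      then have "\<nu> 2 = \<nu> 1" by (simp only: \<nu>_def mom_1)
      then have \<beta>1: "\<beta> 1 = 1" using \<beta>eq[of 1] \<nu>_pos[of 1] by (simp add: numeral_2_eq_2)
      have "y * 1 \<le> Y" unfolding Y_def using ln3 y0 by (intro mult_left_mono) auto
      then have yle: "y \<le> 1" using Y1 by simp
      have ayx: "a * y / x \<le> 1" "0 < a * y / x"
        using yle y0 assms(3,4) x mult_mono[of a x y 1] by (auto simp: divide_le_eq)
      obtain d where "\<And>k1 k2. G (k1 + 0, k2 + 1) / G (k1, k2) \<le> d" using Gbd[of 0 1] by blast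
      then have \<beta>: "\<bar>?\<beta> k\<bar> \<le> d" for k
        unfolding beta using Gpos by (cases k) (simp add: abs_divide abs_of_pos)
      have mono1: "(?\<alpha> (k1, k2))\<^sup>2 \<le> (?\<alpha> (Suc k1, k2))\<^sup>2" for k1 k2
        using x1 a1 by (simp add: weight_alpha_def)
      have mono2: "(?\<beta> (k1, k2))\<^sup>2 \<le> (?\<beta> (k1, Suc k2))\<^sup>2" for k1 k2
      proof (cases "k2 = 0")
        case True
        then show ?thesis using yle y0 ayx \<beta>1 by (simp add: weight_beta_def power_le_one)
      next
        case False
        then have "\<beta> k2 \<le> \<beta> (Suc k2)" "0 \<le> \<beta> k2"
          using \<nu>_log_convex[of k2] \<beta>eq[of k2] \<beta>eq[of "Suc k2"] assms(1)[of k2] by auto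
        then show ?thesis using False by (simp add: weight_beta_def power_mono)
      qed
      have det: "(?\<alpha> (k1, Suc k2) * ?\<beta> (Suc k1, k2) - ?\<alpha> (k1, k2) * ?\<beta> (k1, k2))\<^sup>2
        \<le> ((?\<alpha> (Suc k1, k2))\<^sup>2 - (?\<alpha> (k1, k2))\<^sup>2) * ((?\<beta> (k1, Suc k2))\<^sup>2 - (?\<beta> (k1, k2))\<^sup>2)" for k1 k2
      proof (cases "k1 = 0 \<and> k2 = 0")
        case True
        \<comment> \<open>With \<open>\<beta> 1 = 1\<close> the condition at the origin is (a^2 y/x
          - x y)^2 \<le> (1 - x^2)(1 - y^2). Multiplied by x^2 it becomes y^2 Q \<le> x^2 (1 - x^2),
          that is, y \<le> M1.\<close>
        have "a * (a * y / x) - x * y = y * (a\<^sup>2 - x\<^sup>2) / x"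
          using x by (simp add: field_simps power2_eq_square)
        then have "(a * (a * y / x) - x * y)\<^sup>2 = y\<^sup>2 * (Q - x\<^sup>2 * (1 - x\<^sup>2)) / x\<^sup>2"
          unfolding Q1 by (simp add: power_divide power_mult_distrib power2_commute)
        also have "\<dots> \<le> (1 - x\<^sup>2) * (1 - y\<^sup>2)"
        proof -
          have "y\<^sup>2 * (Q - x\<^sup>2 * (1 - x\<^sup>2)) \<le> (1 - x\<^sup>2) * (1 - y\<^sup>2) * x\<^sup>2"
            using yQ by (simp add: algebra_simps)
          then show ?thesis using x by (simp add: pos_divide_le_eq)
        qed
        finally show ?thesis using True \<beta>1 by (simp add: weight_alpha_def weight_beta_def)
      next
        case False
        \<comment> \<open>Away from the origin the relevant \<alpha> weights agree in adjacent rows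
          and the \<beta> weights in adjacent columns.\<close>
        then have "?\<alpha> (k1, Suc k2) * ?\<beta> (Suc k1, k2) - ?\<alpha> (k1, k2) * ?\<beta> (k1, k2) = 0"
          by (auto simp: weight_alpha_def weight_beta_def)
        then show ?thesis using mono1 mono2 by simp
      qed
      show ?thesis unfolding T by (rule jointly_hyponormal_two_variable_shiftI[OF \<alpha> \<beta> mono1 mono2 det])
    qed

    \<comment> \<open>Absence of a commuting normal extension\<close>
    have notin: "(T1, T2) \<notin> H_infinity TYPE('k)"
    proof
      assume "(T1, T2) \<in> H_infinity TYPE('k)"
      then obtain V :: "(nat \<times> nat) ell2 \<Rightarrow> 'k" and N1 N2 where V: "isometric_embedding V"
        and N1: "normal_operator N1" and N2: "normal_operator N2" and N12: "N1 \<circ> N2 = N2 \<circ> N1"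
        and NV1: "\<And>x. N1 (V x) = V (T1 x)" and NV2: "\<And>x. N2 (V x) = V (T2 x)"
        unfolding H_infinity_def subnormal_pair_def by blast
      define W where "W = V (ket (0, 0))"
      have p2: "(N2 ^^ l) (V v) = V ((T2 ^^ l) v)" for l v
        by (induction l) (auto simp: NV2)
      have p1: "(N1 ^^ i) (V v) = V ((T1 ^^ i) v)" for i v
        by (induction i) (auto simp: NV1)
      have G00: "G (0, 0) = 1" by (simp add: Geq g \<nu>_0)
      have nrm: "norm ((N1 ^^ i) ((N2 ^^ l) W)) = G (i, l)" for i l
      proof -
        have "norm ((N1 ^^ i) ((N2 ^^ l) W)) = norm (((T1 ^^ i) \<circ> (T2 ^^ l)) (ket (0, 0)))"
          using V by (simp add: W_def p1 p2 isometric_embedding_def)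
        also have "\<dots> = G (i, l)"
          unfolding T12 lattice_shift_ket[of G, OF Gpos Gbd] norm_scaleC
          using Gpos[of "(i, l)"] by (simp add: G00)
        finally show ?thesis .
      qed
      \<comment> \<open>From k1 = 1 on the norms do not depend on k1, so N1 preserves the norms of
        the vectors \<open>N1 ((N2 ^^ l) W)\<close> twice in a row, as the kernel argument
        requires.\<close>
      have G1: "G (Suc i, l) = G (1, l)" for i l by (simp add: Geq g)
      obtain f where f: "\<And>l. (norm ((N2 ^^ l) f))\<^sup>2
          = (norm ((N2 ^^ l) W))\<^sup>2 - (norm (N1 ((N2 ^^ l) W)))\<^sup>2"
      proof (rule commuting_normal_kernel_part[OF N1 _ N12, of W])
        show "bounded_clinear N2" using N2 by (simp add: normal_operator_def)
        fix l
        show "norm (N1 (N1 ((N2 ^^ l) W))) = norm (N1 ((N2 ^^ l) W))"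
          using nrm[of 1 l] nrm[of 2 l] G1[of 1 l] by (simp add: numeral_2_eq_2)
        show "norm (N1 (N1 (N1 ((N2 ^^ l) W)))) = norm (N1 ((N2 ^^ l) W))"
          using nrm[of 1 l] nrm[of 3 l] G1[of 2 l] by (simp add: numeral_3_eq_3)
      qed blast
      have f': "(norm ((N2 ^^ l) f))\<^sup>2 = (G (0, l))\<^sup>2 - (G (1, l))\<^sup>2" for l
        using f[of l] nrm[of 0 l] nrm[of 1 l] by simp
      \<comment> \<open>For l \<ge> 1 the columns k1 = 0 and k1 = 1 carry the factors 1 and a, so
        their squared norms differ by y^2 (1 - a^2) times \<open>mom l\<close>.\<close>
      have "y\<^sup>2 * (1 - a\<^sup>2) * ln 3 \<le> (norm f)\<^sup>2"
      proof (rule normal_moment_bound[OF N2])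
        show "0 \<le> y\<^sup>2 * (1 - a\<^sup>2)" using a1 by simp
        fix l :: nat assume "l \<ge> 1"
        then have "(G (0, l))\<^sup>2 - (G (1, l))\<^sup>2 = Y\<^sup>2 * (1 - a\<^sup>2) * (\<nu> l)\<^sup>2"
          by (simp add: Geq g power_mult_distrib algebra_simps)
        also have "\<dots> = y\<^sup>2 * (1 - a\<^sup>2) * mom l" using ln3 by (simp add: Yy \<nu>_power2)
        finally show "(norm ((N2 ^^ l) f))\<^sup>2 = y\<^sup>2 * (1 - a\<^sup>2) * mom l" by (simp add: f')
      qed
      also have "(norm f)\<^sup>2 = 1 - x\<^sup>2" using f'[of 0] by (simp add: Geq g \<nu>_0)
      finally have "y\<^sup>2 \<le> s\<^sup>2" unfolding s2 using a1 ln3 by (simp add: le_divide_eq mult_ac)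
      then show False using y1 s0 y0 by (simp add: abs_le_square_iff[symmetric])
    qed
    show ?thesis using H0 hyp notin sub by (simp add: H_1_def T12)
  qed
  then show ?thesis using sM by blast
qed

end
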